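(* As $n\to\infty$, \[ \ln g(n) = \frac{1}{n-2}\binom{n}{3}\ln\bigl(\mathrm{e}^{1+\beta} n + o(n)\bigr), \] where $\beta = \sup_{u\in C^1_\blacktriangle([0,1])}\int_0^1 F(x,u(x))\,dx$.
   Context: A set $\mathcal{X}$ of $3$-element subsets (triples) of $[n]=\{1,\dots,n\}$ is good if (i) for any two distinct triples $\{a_1<a_2<a_3\}$ and $\{b_1<b_2<b_3\}$ in $\mathcal{X}$ with $a_2=b_2$, one has $a_1\ne b_1$ and $a_3\ne b_3$; and (ii) $|\mathcal{X}|\le\frac{1}{n-2}\binom{n}{3}$. $g(n)$ is the number of good sets of triples of $[n]$. Let $h(y)=(1-y)\ln(1-y)$ for $0\le y<1$ and $h(1)=0$; for $0\le y\le\min\{x,1-x\}$, $F(x,y) = -2 - 6x\,h(y/x) - 6(1-x)\,h(y/(1-x)) - 6y\ln\bigl(y/(x(1-x))\bigr)$ (with $0\ln 0=0$). $C^1_\blacktriangle([0,1])$ is the set of continuously differentiable $u:[0,1]\to\mathbb{R}$ with $\int_0^1 u = 1/6$ and $0\le u(x)\le\min\{x,1-x\}$ for all $x$. *)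

theory Defs
  imports "HOL-Analysis.Analysis" "HOL-Library.Landau_Symbols"
begin

definition good_triples :: "nat \<Rightarrow> nat set set \<Rightarrow> bool" where
  "good_triples n X \<longleftrightarrow>
     (\<forall>T\<in>X. T \<subseteq> {1..n} \<and> card T = 3) \<and>
     (\<forall>a1 a2 a3 b1 b2 b3.
        {a1, a2, a3} \<in> X \<and> a1 < a2 \<and> a2 < a3 \<and>
        {b1, b2, b3} \<in> X \<and> b1 < b2 \<and> b2 < b3 \<and>
        {a1, a2, a3} \<noteq> {b1, b2, b3} \<and> a2 = b2 \<longrightarrow> a1 \<noteq> b1 \<and> a3 \<noteq> b3) \<and>
     real (card X) \<le> 1 / (real n - 2) * real (n choose 3)"

definition g :: "nat \<Rightarrow> nat" where
  "g n = card {X. good_triples n X}"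

definition h :: "real \<Rightarrow> real" where
  "h y = (if y = 1 then 0 else (1 - y) * ln (1 - y))"

text \<open>Only the values for \<open>0 \<le> y \<le> min x (1 - x)\<close> are meaningful. On that domain, division
  by zero occurs only where \<open>y = 0\<close>, and the affected terms then vanish.\<close>

definition F :: "real \<Rightarrow> real \<Rightarrow> real" where
  "F x y = - 2 - 6 * x * h (y / x) - 6 * (1 - x) * h (y / (1 - x))
             - 6 * y * ln (y / (x * (1 - x)))"

text \<open>Functions on \<open>[0,1]\<close> are represented by total functions whose values outside \<open>[0,1]\<close> are
  irrelevant; derivatives at the endpoints are one-sided.\<close>

definition C1_tri :: "(real \<Rightarrow> real) set" where
  "C1_tri = {u.
     (\<exists>u'. continuous_on {0..1} u' \<and>
           (\<forall>x\<in>{0..1}. (u has_real_derivative u' x) (at x within {0..1}))) \<and>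
     integral {0..1} u = 1 / 6 \<and>
     (\<forall>x\<in>{0..1}. 0 \<le> u x \<and> u x \<le> min x (1 - x))}"

definition beta :: real where
  "beta = (SUP u\<in>C1_tri. integral {0..1} (\<lambda>x. F x (u x)))"

text \<open>The supremum is taken over a nonempty set of reals that is bounded above, and every
  integrand is integrable.\<close>

lemma C1_tri_nonempty: "(\<lambda>x. x * (1 - x)) \<in> C1_tri"
proof -
  have "((\<lambda>x::real. x * (1 - x)) has_integral (1^2/2 - 1^3/3) - (0^2/2 - 0^3/3)) {0..1}"
    by (rule fundamental_theorem_of_calculus)
       (auto intro!: derivative_eq_intros
             simp: has_real_derivative_iff_has_vector_derivative [symmetric] power2_eq_square algebra_simps)
  then have "integral {0..1} (\<lambda>x::real. x * (1 - x)) = 1 / 6"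
    by (simp add: integral_unique)
  moreover have "continuous_on {0..1} (\<lambda>x::real. 1 - 2 * x) \<and>
      (\<forall>x\<in>{0..1}. ((\<lambda>x. x * (1 - x)) has_real_derivative 1 - 2 * x) (at x within {0..1}))"
    by (auto intro!: continuous_intros derivative_eq_intros)
  moreover have "x * (1 - x) \<le> x" "x * (1 - x) \<le> 1 - x" if "x \<in> {0..1}" for x :: real
    using that by (auto simp: mult_left_le mult_left_le_one_le)
  ultimately show ?thesis
    unfolding C1_tri_def by (auto intro: exI[of _ "\<lambda>x. 1 - 2 * x"])
qed

lemma neg_x_ln_x_le: "- (t * ln t) \<le> (1::real)" if "t \<ge> 0"
proof (cases "t = 0")
  case False
  with that have t: "t > 0" by simp
  have "- ln t = ln (1 / t)" using t by (simp add: ln_div)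
  also have "\<dots> \<le> 1 / t - 1" using t by (intro ln_le_minus_one) simp
  finally have "t * (- ln t) \<le> t * (1 / t - 1)" using t by (intro mult_left_mono) auto
  also have "\<dots> = 1 - t" using t by (simp add: field_simps)
  finally show ?thesis using t by simp
qed auto

lemma abs_x_ln_x_le: "\<bar>t * ln t\<bar> \<le> (2::real)" if "0 \<le> t" "t \<le> 2"
proof (cases "t = 0")
  case False
  with that have "t * ln t \<le> t * (t - 1)" by (intro mult_left_mono ln_le_minus_one) auto
  also have "\<dots> \<le> 2 * 1" 
  proof -
    have "t * (t - 1) \<le> t * 1" using that by (intro mult_left_mono) auto
    then show ?thesis using that by simp
  qed
  finally show ?thesis using neg_x_ln_x_le[of t] that by linarith
qed auto

lemma abs_F_le: "\<bar>F x y\<bar> \<le> 38" if x: "0 \<le> x" "x \<le> 1" and y: "0 \<le> y" "y \<le> min x (1 - x)"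
proof -
  have h: "\<bar>z * h (y / z)\<bar> \<le> 2" if z: "0 \<le> z" "z \<le> 1" "y \<le> z" for z
  proof -
    have "y / z \<le> 1" "0 \<le> y / z" using z y by (auto simp: divide_le_eq_1)
    then have "\<bar>h (y / z)\<bar> \<le> 2"
      using abs_x_ln_x_le[of "1 - y / z"] by (auto simp: h_def)
    then have "\<bar>z\<bar> * \<bar>h (y / z)\<bar> \<le> 1 * 2" using z by (intro mult_mono) auto
    then show ?thesis by (simp add: abs_mult)
  qed
  have 3: "\<bar>y * ln (y / (x * (1 - x)))\<bar> \<le> 2"
  proof (cases "x * (1 - x) = 0")
    case True
    then have "y = 0" using x y by auto
    then show ?thesis by simp
  next
    case False
    define w where "w = x * (1 - x)"
    have w: "w > 0" "w \<le> 1" using False x by (auto simp: w_def mult_le_one)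
    have "min x (1 - x) \<le> 2 * w"
    proof (cases "x \<le> 1 / 2")
      case True
      have "x * 1 \<le> x * (2 * (1 - x))" using True x by (intro mult_left_mono) auto
      then show ?thesis by (simp add: w_def algebra_simps min_le_iff_disj)
    next
      case False
      have "(1 - x) * 1 \<le> (1 - x) * (2 * x)" using False x by (intro mult_left_mono) auto
      then show ?thesis by (simp add: w_def algebra_simps min_le_iff_disj)
    qed
    with y have "y \<le> 2 * w" by linarith
    then have "y / w \<le> 2" using w by (simp add: divide_le_eq)
    then have "\<bar>y / w * ln (y / w)\<bar> \<le> 2" using w y by (intro abs_x_ln_x_le) auto
    then have "\<bar>w\<bar> * \<bar>y / w * ln (y / w)\<bar> \<le> 1 * 2" using w by (intro mult_mono) auto
    then have "\<bar>w * (y / w * ln (y / w))\<bar> \<le> 2" by (simp only: abs_mult mult_1)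
    then have "\<bar>y * ln (y / w)\<bar> \<le> 2" using w by simp
    then show ?thesis by (simp only: w_def)
  qed
  have "F x y = - 2 - 6 * (x * h (y / x)) - 6 * ((1 - x) * h (y / (1 - x)))
                - 6 * (y * ln (y / (x * (1 - x))))"
    by (simp add: F_def)
  moreover have "\<bar>x * h (y / x)\<bar> \<le> 2" "\<bar>(1 - x) * h (y / (1 - x))\<bar> \<le> 2"
    using h[of x] h[of "1 - x"] x y by auto
  ultimately show ?thesis using 3 by linarith
qed

lemma F_integrable: "(\<lambda>x. F x (u x)) integrable_on {0..1}" if u: "u \<in> C1_tri"
proof -
  define v where "v x = indicator {0..1} x *\<^sub>R u x" for x :: real
  have "continuous_on {0..1} u"
    using u unfolding C1_tri_def by (blast intro: DERIV_continuous_on)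
  then have [measurable]: "v \<in> borel_measurable borel"
    unfolding v_def by (intro borel_measurable_continuous_on_indicator) auto
  have [measurable]: "h \<in> borel_measurable borel"
    unfolding h_def by measurable
  have "(\<lambda>x. F x (v x)) \<in> borel_measurable borel"
    unfolding F_def by measurable
  then have "(\<lambda>x. F x (v x)) \<in> borel_measurable (lebesgue_on {0..1})"
    by (simp add: measurable_completion measurable_restrict_space1)
  then have "(\<lambda>x. F x (v x)) integrable_on {0..1}"
  proof (rule measurable_bounded_by_integrable_imp_integrable)
    show "(\<lambda>x::real. 38::real) integrable_on {0..1}" by (rule integrable_const_ivl)
    show "norm (F x (v x)) \<le> 38" if "x \<in> {0..1}" for x
      using that u abs_F_le[of x "u x"] by (auto simp: C1_tri_def v_def)
  qed auto
  then show ?thesis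
    by (rule integrable_eq) (auto simp: v_def)
qed

lemma bdd_above_F: "bdd_above ((\<lambda>u. integral {0..1} (\<lambda>x. F x (u x))) ` C1_tri)"
proof (rule bdd_aboveI2)
  fix u assume u: "u \<in> C1_tri"
  have "F x (u x) \<le> 38" if "x \<in> {0..1}" for x
    using that u abs_F_le[of x "u x"] by (auto simp: C1_tri_def)
  then have "integral {0..1} (\<lambda>x. F x (u x)) \<le> integral {0..1} (\<lambda>x::real. 38)"
    using F_integrable[OF u] by (intro integral_le) auto
  then show "integral {0..1} (\<lambda>x. F x (u x)) \<le> 38" by simp
qed

end

theory Submission
  imports Defs "HOL-Real_Asymp.Real_Asymp"
begin

text \<open>
  Sorting the triples of a good set by their middle element \<open>j\<close> turns it into a family of matchings,
  one in each complete bipartite graph between \<open>{1..<j}\<close> and \<open>{j<..n}\<close>, of total size at most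
  \<open>N = n (n - 1) / 6\<close>. With \<open>x = j / n\<close> and \<open>y = k / n\<close>, Stirling's formula gives
  \<open>n G(x, y) + k (ln n - 1)\<close>, up to \<open>o(n)\<close>, for the logarithm of the number of matchings of size \<open>k\<close>,
  where \<open>F = 6 G - 2\<close>.

  The variational problem is concave in \<open>u\<close> and has an explicit solution: the stationarity condition
  with Lagrange multiplier \<open>ln c + 1\<close> is the quadratic equation \<open>(x - u) (1 - x - u) = c u\<close>, its smaller
  root is a \<open>C\<^sup>1\<close>, 1-Lipschitz function of \<open>x\<close>, and \<open>c\<close> is fixed by the intermediate value theorem so
  that the integral is \<open>1/6\<close>. The tangent inequality
  \<open>G(x, y) \<le> G(x, u) + (ln c + 1) (y - u)\<close> shows both that this \<open>u\<close> attains \<open>\<beta>\<close> and, with each family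
  weighted by \<open>z = c n\<close> to the power of its deficit \<open>N - s\<close>, the upper bound for \<open>g(n)\<close>. The lower
  bound counts the families whose sizes are \<open>n u(j / n)\<close> up to rounding.
\<close>

section \<open>Matchings and good sets of triples\<close>

definition matchings :: "'a set \<Rightarrow> 'b set \<Rightarrow> ('a \<times> 'b) set set" where
  "matchings A B = {M. M \<subseteq> A \<times> B \<and> inj_on fst M \<and> inj_on snd M}"

text \<open>This is \<open>(a choose k) * (b choose k) * fact k\<close>, the number of matchings of
  size \<open>k\<close> between sets of sizes \<open>a\<close> and \<open>b\<close>, written as a
  quotient of factorials so that its logarithm splits into five terms. It has this meaning only for
  \<open>k\<close> at most \<open>min a b\<close>, since the subtractions truncate.\<close>

definition matching_count :: "nat \<Rightarrow> nat \<Rightarrow> nat \<Rightarrow> real" where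
  "matching_count a b k = fact a * fact b / (fact k * fact (a - k) * fact (b - k))"

lemma finite_matchings: "finite A \<Longrightarrow> finite B \<Longrightarrow> finite (matchings A B)"
  by (rule finite_subset[of _ "Pow (A \<times> B)"]) (auto simp: matchings_def)

lemma matching_count_pos: "matching_count a b k > 0"
  by (simp add: matching_count_def)

lemma card_matching_le:
  assumes "finite A" "finite B" "M \<in> matchings A B"
  shows "card M \<le> min (card A) (card B)"
proof -
  have "card M = card (fst ` M)" "card M = card (snd ` M)"
    using assms by (simp_all add: matchings_def card_image)
  moreover have "fst ` M \<subseteq> A" "snd ` M \<subseteq> B"
    using assms by (auto simp: matchings_def)
  ultimately show ?thesis
    using assms by (metis card_mono min.boundedI)
qed

text \<open>A matching is the graph of an injective partial function from \<open>A\<close> to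
  \<open>B\<close>; \<open>S\<close> is its domain. Extensionality of \<open>f\<close> outside
  \<open>S\<close> makes the pair unique.\<close>

lemma bij_betw_matchings:
  "bij_betw (\<lambda>(S, f). (\<lambda>x. (x, f x)) ` S)
     (SIGMA S:{S. S \<subseteq> A \<and> card S = k}. {f \<in> S \<rightarrow>\<^sub>E B. inj_on f S})
     {M \<in> matchings A B. card M = k}"
  (is "bij_betw ?\<phi> ?P ?Q")
  unfolding bij_betw_def
proof
  show "inj_on ?\<phi> ?P"
  proof (rule inj_onI, clarify, rule conjI)
    fix S f S' f'
    assume eq: "(\<lambda>x. (x, f x)) ` S = (\<lambda>x. (x, f' x)) ` S'"
      and f: "f \<in> S \<rightarrow>\<^sub>E B" and f': "f' \<in> S' \<rightarrow>\<^sub>E B"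
    have "fst ` (\<lambda>x. (x, f x)) ` S = fst ` (\<lambda>x. (x, f' x)) ` S'"
      by (simp only: eq)
    then show S: "S = S'" by (simp add: image_image)
    show "f = f'"
    proof (rule PiE_ext[OF f])
      show "f' \<in> S \<rightarrow>\<^sub>E B" using f' S by simp
      fix x assume "x \<in> S"
      then have "(x, f x) \<in> (\<lambda>x. (x, f' x)) ` S'" using eq by blast
      then show "f x = f' x" by auto
    qed
  qed
  show "?\<phi> ` ?P = ?Q"
  proof
    show "?\<phi> ` ?P \<subseteq> ?Q"
      by (auto simp: matchings_def inj_on_def PiE_mem intro!: card_image)
    show "?Q \<subseteq> ?\<phi> ` ?P"
    proof
      fix M assume M: "M \<in> ?Q"
      \<comment> \<open>The partner of \<open>x\<close> is read off by inverting \<open>fst\<close>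
        on \<open>M\<close>, which is possible because \<open>fst\<close> is injective
        there.\<close>
      define f where "f = (\<lambda>x\<in>fst ` M. snd (the_inv_into M fst x))"
      have inj: "inj_on fst M" "inj_on snd M" and sub: "M \<subseteq> A \<times> B" and card: "card M = k"
        using M by (auto simp: matchings_def)
      have f: "f (fst p) = snd p" if "p \<in> M" for p
        using that inj by (simp add: f_def the_inv_into_f_f)
      have "M = (\<lambda>x. (x, f x)) ` fst ` M"
        by (simp add: image_image f)
      moreover have "f \<in> fst ` M \<rightarrow>\<^sub>E B"
        using sub f by (fastforce simp: f_def intro!: PiE_I)
      moreover have "inj_on f (fst ` M)"
        using inj f by (auto simp: inj_on_def)
      moreover have "fst ` M \<subseteq> A" "card (fst ` M) = k"
        using sub card inj by (auto simp: card_image)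
      ultimately show "M \<in> ?\<phi> ` ?P" by (intro image_eqI[of _ _ "(fst ` M, f)"]) auto
    qed
  qed
qed

lemma prod_diff_eq_fact_quotient:
  "k \<le> b \<Longrightarrow> real (prod ((-) b) {0..<k}) = fact b / fact (b - k)"
proof (induction k)
  case (Suc k)
  then have "b - k = Suc (b - Suc k)" by simp
  then have "fact (b - k) = real (b - k) * fact (b - Suc k)"
    by (metis fact_Suc)
  with Suc show ?case by (simp add: field_simps)
qed simp

text \<open>The matched subset of \<open>A\<close> can be chosen in \<open>card A choose k\<close>
  ways; the injections of it into \<open>B\<close> are then counted by a falling factorial.\<close>

lemma card_matchings:
  assumes fin: "finite A" "finite B" and k: "k \<le> card A" "k \<le> card B"
  shows "real (card {M \<in> matchings A B. card M = k}) = matching_count (card A) (card B) k"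
proof -
  have "card {M \<in> matchings A B. card M = k} =
      card (SIGMA S:{S. S \<subseteq> A \<and> card S = k}. {f \<in> S \<rightarrow>\<^sub>E B. inj_on f S})"
    by (rule bij_betw_same_card[OF bij_betw_matchings, symmetric])
  also have "\<dots> = (\<Sum>S\<in>{S. S \<subseteq> A \<and> card S = k}. card {f \<in> S \<rightarrow>\<^sub>E B. inj_on f S})"
    using fin by (intro card_SigmaI) (auto intro: finite_subset finite_PiE)
  also have "\<dots> = (\<Sum>S\<in>{S. S \<subseteq> A \<and> card S = k}. prod ((-) (card B)) {0..<k})"
    using fin by (intro sum.cong refl)
      (auto simp: card_inj_on_subset_funcset[OF finite_subset[OF _ fin(1)] fin(2) order_refl])
  also have "\<dots> = (card A choose k) * prod ((-) (card B)) {0..<k}"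
    using fin by (simp add: n_subsets)
  finally have "real (card {M \<in> matchings A B. card M = k}) =
      real (card A choose k) * real (prod ((-) (card B)) {0..<k})"
    by (simp only: of_nat_mult)
  then show ?thesis
    using k by (simp only: prod_diff_eq_fact_quotient binomial_fact matching_count_def) simp
qed

section \<open>Sorting triples by their middle element\<close>

lemma ordered_triple_eqD:
  assumes eq: "{a, j, c} = {a', j', c' :: nat}" and o: "a < j" "j < c" "a' < j'" "j' < c'"
  shows "a = a'" "j = j'" "c = c'"
proof -
  have "Min {a, j, c} = a" "Min {a', j', c'} = a'" "Max {a, j, c} = c" "Max {a', j', c'} = c'"
    using o by auto
  with eq show *: "a = a'" "c = c'" by metis+
  have "j \<in> {a', j', c'}" using eq by blast
  with * o show "j = j'" by auto
qed

lemma inj_on_ordered_triple: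
  "inj_on (\<lambda>(j, a, c). {a, j, c}) {(j :: nat, a, c). a < j \<and> j < c}"
proof (rule inj_onI)
  fix p q :: "nat \<times> nat \<times> nat"
  assume "p \<in> {(j, a, c). a < j \<and> j < c}" "q \<in> {(j, a, c). a < j \<and> j < c}"
    "(\<lambda>(j, a, c). {a, j, c}) p = (\<lambda>(j, a, c). {a, j, c}) q"
  moreover obtain j a c j' a' c' where "p = (j, a, c)" "q = (j', a', c')"
    by (cases p, cases q)
  ultimately show "p = q"
    using ordered_triple_eqD[of a j c a' j' c'] by simp
qed

text \<open>A triple is recorded by its middle element \<open>j\<close> and its pair of extreme elements; condition (i)
  says that for each \<open>j\<close> the recorded pairs form a matching.\<close>

definition middle_matchings :: "nat \<Rightarrow> nat \<Rightarrow> (nat \<times> nat) set set" where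
  "middle_matchings n j = matchings {1..<j} {j<..n}"

definition triples_of :: "nat \<Rightarrow> (nat \<Rightarrow> (nat \<times> nat) set) \<Rightarrow> nat set set" where
  "triples_of n M = (\<lambda>(j, a, c). {a, j, c}) ` (SIGMA j:{1..n}. M j)"

text \<open>Places the indexing set in the region where forming the unordered triple is
  injective.\<close>

lemma middle_matchings_subset:
  assumes "M \<in> PiE {1..n} (middle_matchings n)"
  shows "(SIGMA j:{1..n}. M j) \<subseteq> {(j, a, c). a < j \<and> j < c}"
  using assms by (fastforce simp: middle_matchings_def matchings_def PiE_iff)

lemma finite_middle_matchings: "finite (middle_matchings n j)"
  by (simp add: middle_matchings_def finite_matchings)

lemma finite_middle_matching: "M \<in> middle_matchings n j \<Longrightarrow> finite M"
  by (rule finite_subset[of _ "{1..<j} \<times> {j<..n}"]) (auto simp: middle_matchings_def matchings_def)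

lemma card_triples_of:
  assumes "M \<in> PiE {1..n} (middle_matchings n)"
  shows "card (triples_of n M) = (\<Sum>j\<in>{1..n}. card (M j))"
proof -
  have "card (triples_of n M) = card (SIGMA j:{1..n}. M j)"
    unfolding triples_of_def
    by (intro card_image inj_on_subset[OF inj_on_ordered_triple] middle_matchings_subset assms)
  also have "\<dots> = (\<Sum>j\<in>{1..n}. card (M j))"
    using assms by (intro card_SigmaI) (auto simp: PiE_iff intro: finite_middle_matching)
  finally show ?thesis .
qed

lemma inj_on_triples_of: "inj_on (triples_of n) (PiE {1..n} (middle_matchings n))"
proof (rule inj_onI)
  fix M M' assume M: "M \<in> PiE {1..n} (middle_matchings n)" "M' \<in> PiE {1..n} (middle_matchings n)"
    and "triples_of n M = triples_of n M'"
  then have eq: "(SIGMA j:{1..n}. M j) = (SIGMA j:{1..n}. M' j)"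
    using inj_on_image_eq_iff[OF inj_on_ordered_triple M[THEN middle_matchings_subset]]
    by (simp only: triples_of_def)
  show "M = M'"
    by (rule PiE_ext[OF M]) (use eq in blast)
qed

lemma ordered_triple_exhaust:
  assumes "card (T :: nat set) = 3"
  obtains a j c where "T = {a, j, c}" "a < j" "j < c"
proof -
  obtain x y z where T: "T = {x, y, z}" and ne: "x \<noteq> y" "y \<noteq> z" "x \<noteq> z"
    using assms by (auto simp: card_3_iff)
  consider "x < y \<and> y < z" | "x < z \<and> z < y" | "y < x \<and> x < z" | "y < z \<and> z < x"
    | "z < x \<and> x < y" | "z < y \<and> y < x"
    using ne by linarith
  then show thesis
    by cases (use T that in \<open>metis insert_commute\<close>)+
qed

text \<open>Two triples with the same middle element \<open>j\<close> come from the same matching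
  \<open>M j\<close>, so condition (i) is injectivity of the two projections on \<open>M j\<close>;
  the size hypothesis becomes condition (ii).\<close>

lemma good_triples_triples_of:
  assumes M: "M \<in> PiE {1..n} (middle_matchings n)"
    and card: "real (\<Sum>j\<in>{1..n}. card (M j)) \<le> 1 / (real n - 2) * real (n choose 3)"
  shows "good_triples n (triples_of n M)"
  unfolding good_triples_def
proof (intro conjI ballI allI impI)
  have Mj: "M j \<subseteq> {1..<j} \<times> {j<..n}" "inj_on fst (M j)" "inj_on snd (M j)" if "j \<in> {1..n}" for j
    using M that by (auto simp: PiE_iff middle_matchings_def matchings_def)
  \<comment> \<open>Membership only provides some presentation of the unordered triple; since both
    presentations are sorted, they coincide.\<close>
  have mem: "j \<in> {1..n} \<and> (a, c) \<in> M j" if t: "{a, j, c} \<in> triples_of n M" "a < j" "j < c" for a j c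
  proof -
    obtain j' a' c' where *: "{a, j, c} = {a', j', c'}" "j' \<in> {1..n}" "(a', c') \<in> M j'"
      using t by (auto simp: triples_of_def)
    moreover have "a' < j'" "j' < c'" using Mj(1)[OF *(2)] *(3) by auto
    ultimately show ?thesis using ordered_triple_eqD[OF *(1)] t by metis
  qed
  {
    fix T assume "T \<in> triples_of n M"
    then obtain j a c where *: "T = {a, j, c}" "j \<in> {1..n}" "(a, c) \<in> M j"
      by (auto simp: triples_of_def)
    moreover have "a \<in> {1..<j}" "c \<in> {j<..n}" using Mj(1)[OF *(2)] *(3) by auto
    ultimately show "T \<subseteq> {1..n}" "card T = 3" by (auto simp: card_insert_if)
  }
  {
    fix a1 a2 a3 b1 b2 b3
    assume *: "{a1, a2, a3} \<in> triples_of n M \<and> a1 < a2 \<and> a2 < a3 \<and>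
        {b1, b2, b3} \<in> triples_of n M \<and> b1 < b2 \<and> b2 < b3 \<and>
        {a1, a2, a3} \<noteq> {b1, b2, b3} \<and> a2 = b2"
    then have "a2 \<in> {1..n}" "(a1, a3) \<in> M a2" "(b1, b3) \<in> M a2"
      using mem by blast+
    with * show "a1 \<noteq> b1" "a3 \<noteq> b3"
      using inj_onD[OF Mj(2), of a2 "(a1, a3)" "(b1, b3)"]
        inj_onD[OF Mj(3), of a2 "(a1, a3)" "(b1, b3)"] by auto
  }
  show "real (card (triples_of n M)) \<le> 1 / (real n - 2) * real (n choose 3)"
    using card by (simp only: card_triples_of[OF M])
qed

text \<open>The inverse construction: \<open>M j\<close> collects the outer pairs of the triples
  with middle element \<open>j\<close>, and condition (i) makes both projections injective on
  it.\<close>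

lemma good_triples_eq_triples_of:
  assumes X: "good_triples n X"
  obtains M where "M \<in> PiE {1..n} (middle_matchings n)" "X = triples_of n M"
proof
  define M where "M = (\<lambda>j\<in>{1..n}. {(a, c). a < j \<and> j < c \<and> {a, j, c} \<in> X})"
  have sub: "\<And>T. T \<in> X \<Longrightarrow> T \<subseteq> {1..n}" and three: "\<And>T. T \<in> X \<Longrightarrow> card T = 3"
    using X by (auto simp: good_triples_def)
  have sep: "a \<noteq> a' \<and> c \<noteq> c'"
    if "{a, j, c} \<in> X" "a < j" "j < c" "{a', j, c'} \<in> X" "a' < j" "j < c'" "(a, c) \<noteq> (a', c')"
    for a j c a' c'
  proof -
    have "{a, j, c} \<noteq> {a', j, c'}" using that ordered_triple_eqD[of a j c a' j c'] by auto
    moreover have "\<forall>a1 a2 a3 b1 b2 b3. {a1, a2, a3} \<in> X \<and> a1 < a2 \<and> a2 < a3 \<and>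
        {b1, b2, b3} \<in> X \<and> b1 < b2 \<and> b2 < b3 \<and>
        {a1, a2, a3} \<noteq> {b1, b2, b3} \<and> a2 = b2 \<longrightarrow> a1 \<noteq> b1 \<and> a3 \<noteq> b3"
      using X unfolding good_triples_def by (elim conjE)
    ultimately show ?thesis using that by (metis (no_types, lifting))
  qed
  show "M \<in> PiE {1..n} (middle_matchings n)"
  proof (rule PiE_I)
    fix j assume j: "j \<in> {1..n}"
    have "M j \<subseteq> {1..<j} \<times> {j<..n}"
      using j sub by (fastforce simp: M_def)
    moreover have "inj_on fst (M j)" "inj_on snd (M j)"
      using j sep by (fastforce simp: M_def inj_on_def)+
    ultimately show "M j \<in> middle_matchings n j"
      by (simp add: middle_matchings_def matchings_def)
  qed (auto simp: M_def)
  show "X = triples_of n M"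
  proof
    show "X \<subseteq> triples_of n M"
    proof
      fix T assume T: "T \<in> X"
      obtain a j c where *: "T = {a, j, c}" "a < j" "j < c"
        using three[OF T] by (rule ordered_triple_exhaust)
      then have "j \<in> {1..n}" using sub[OF T] by auto
      with * T show "T \<in> triples_of n M"
        unfolding triples_of_def by (intro image_eqI[of _ _ "(j, a, c)"]) (auto simp: M_def)
    qed
    show "triples_of n M \<subseteq> X"
      by (auto simp: triples_of_def M_def)
  qed
qed

text \<open>\<open>triples_of\<close> is injective and turns total size into cardinality, so
  condition (ii) carries over unchanged.\<close>

lemma g_eq_card_families:
  "g n = card {M \<in> PiE {1..n} (middle_matchings n).
     real (\<Sum>j\<in>{1..n}. card (M j)) \<le> 1 / (real n - 2) * real (n choose 3)}"
  (is "_ = card ?S")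
proof -
  have "{X. good_triples n X} = triples_of n ` ?S"
  proof
    show "{X. good_triples n X} \<subseteq> triples_of n ` ?S"
    proof
      fix X assume "X \<in> {X. good_triples n X}"
      then have X: "good_triples n X" by simp
      then obtain M where M: "M \<in> PiE {1..n} (middle_matchings n)" "X = triples_of n M"
        by (rule good_triples_eq_triples_of)
      have "real (card X) \<le> 1 / (real n - 2) * real (n choose 3)"
        using X by (simp only: good_triples_def)
      with M show "X \<in> triples_of n ` ?S"
        by (simp only: card_triples_of) blast
    qed
    show "triples_of n ` ?S \<subseteq> {X. good_triples n X}"
      using good_triples_triples_of by blast
  qed
  moreover have "inj_on (triples_of n) ?S"
    by (rule inj_on_subset[OF inj_on_triples_of]) auto
  ultimately show ?thesis by (simp add: g_def card_image)
qed

section \<open>Bounding the number of families from both sides\<close>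

lemma finite_families: "finite (PiE {1..n} (middle_matchings n))"
  by (intro finite_PiE finite_middle_matchings) auto

text \<open>Once the size of each matching is prescribed, the choices for different \<open>j\<close>
  are independent, and all resulting families satisfy the size condition.\<close>

lemma g_lower_bound:
  assumes k: "\<And>j. j \<in> {1..n} \<Longrightarrow> k j \<le> min (j - 1) (n - j)"
    and sum: "real (\<Sum>j\<in>{1..n}. k j) \<le> 1 / (real n - 2) * real (n choose 3)"
  shows "(\<Prod>j\<in>{1..n}. matching_count (j - 1) (n - j) (k j)) \<le> real (g n)"
proof -
  have "(\<Prod>j\<in>{1..n}. matching_count (j - 1) (n - j) (k j)) =
      (\<Prod>j\<in>{1..n}. real (card {M \<in> middle_matchings n j. card M = k j}))"
    using k by (intro prod.cong refl)
      (simp add: middle_matchings_def card_matchings)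
  also have "\<dots> = real (card (PiE {1..n} (\<lambda>j. {M \<in> middle_matchings n j. card M = k j})))"
    by (simp add: card_PiE)
  also have "\<dots> \<le> real (g n)"
    unfolding g_eq_card_families
  proof (intro of_nat_mono card_mono)
    show "finite {M \<in> PiE {1..n} (middle_matchings n).
        real (\<Sum>j\<in>{1..n}. card (M j)) \<le> 1 / (real n - 2) * real (n choose 3)}"
      by (rule finite_subset[OF _ finite_families]) auto
    show "PiE {1..n} (\<lambda>j. {M \<in> middle_matchings n j. card M = k j}) \<subseteq>
        {M \<in> PiE {1..n} (middle_matchings n).
          real (\<Sum>j\<in>{1..n}. card (M j)) \<le> 1 / (real n - 2) * real (n choose 3)}"
    proof
      fix M assume M: "M \<in> PiE {1..n} (\<lambda>j. {M \<in> middle_matchings n j. card M = k j})"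
      then have "(\<Sum>j\<in>{1..n}. card (M j)) = (\<Sum>j\<in>{1..n}. k j)"
        by (intro sum.cong refl) (auto simp: PiE_iff)
      with M sum show "M \<in> {M \<in> PiE {1..n} (middle_matchings n).
          real (\<Sum>j\<in>{1..n}. card (M j)) \<le> 1 / (real n - 2) * real (n choose 3)}"
        by (auto simp: PiE_iff simp del: of_nat_sum)
    qed
  qed
  finally show ?thesis .
qed

text \<open>Rankin's trick: a family of total size \<open>s \<le> N\<close> is counted with weight \<open>z powr (N - s) \<ge> 1\<close>,
  after which the sum over families factorises.\<close>

lemma g_upper_bound:
  assumes z: "z \<ge> 1"
  shows "real (g n) \<le> z powr (1 / (real n - 2) * real (n choose 3)) *
     (\<Prod>j\<in>{1..n}. \<Sum>k\<le>min (j - 1) (n - j). matching_count (j - 1) (n - j) k / z ^ k)"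
proof -
  define N where "N = 1 / (real n - 2) * real (n choose 3)"
  define P where "P = PiE {1..n} (middle_matchings n)"
  have inner: "(\<Sum>M\<in>middle_matchings n j. 1 / z ^ card M) =
      (\<Sum>k\<le>min (j - 1) (n - j). matching_count (j - 1) (n - j) k / z ^ k)" if "j \<in> {1..n}" for j
  proof -
    have "(\<Sum>M\<in>middle_matchings n j. 1 / z ^ card M) =
        (\<Sum>k\<le>min (j - 1) (n - j). \<Sum>M\<in>{M \<in> middle_matchings n j. card M = k}. 1 / z ^ card M)"
    proof (intro sum.group[symmetric] finite_middle_matchings finite_atMost)
      show "card ` middle_matchings n j \<subseteq> {..min (j - 1) (n - j)}"
        using card_matching_le[of "{1..<j}" "{j<..n}"] by (auto simp: middle_matchings_def)
    qed
    also have "\<dots> = (\<Sum>k\<le>min (j - 1) (n - j). matching_count (j - 1) (n - j) k / z ^ k)"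
      using card_matchings[of "{1..<j}" "{j<..n}"]
      by (intro sum.cong refl) (simp add: middle_matchings_def)
    finally show ?thesis .
  qed
  have "real (g n) = (\<Sum>M\<in>{M \<in> P. real (\<Sum>j\<in>{1..n}. card (M j)) \<le> N}. 1)"
    unfolding g_eq_card_families P_def N_def by simp
  also have "\<dots> \<le> (\<Sum>M\<in>{M \<in> P. real (\<Sum>j\<in>{1..n}. card (M j)) \<le> N}.
      z powr (N - real (\<Sum>j\<in>{1..n}. card (M j))))"
    using z by (intro sum_mono ge_one_powr_ge_zero) auto
  \<comment> \<open>The size constraint is dropped at the cost of extra nonnegative terms; only the
    unconstrained sum is a product over \<open>j\<close>.\<close>
  also have "\<dots> \<le> (\<Sum>M\<in>P. z powr (N - real (\<Sum>j\<in>{1..n}. card (M j))))"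
    unfolding P_def by (intro sum_mono2 finite_families) auto
  also have "\<dots> = (\<Sum>M\<in>P. z powr N * (\<Prod>j\<in>{1..n}. 1 / z ^ card (M j)))"
    using z by (intro sum.cong refl)
      (simp add: powr_diff powr_realpow power_sum prod_dividef del: of_nat_sum)
  also have "\<dots> = z powr N * (\<Prod>j\<in>{1..n}. \<Sum>M\<in>middle_matchings n j. 1 / z ^ card M)"
    unfolding P_def sum_distrib_left[symmetric]
    by (subst prod_sum_PiE) (auto simp: finite_middle_matchings)
  also have "(\<Prod>j\<in>{1..n}. \<Sum>M\<in>middle_matchings n j. 1 / z ^ card M) =
      (\<Prod>j\<in>{1..n}. \<Sum>k\<le>min (j - 1) (n - j). matching_count (j - 1) (n - j) k / z ^ k)"
    by (intro prod.cong refl inner)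
  finally show ?thesis unfolding N_def .
qed

section \<open>The variational problem\<close>

definition xlnx :: "real \<Rightarrow> real" where
  "xlnx t = t * ln t"

lemma xlnx_0 [simp]: "xlnx 0 = 0"
  by (simp add: xlnx_def)

lemma continuous_on_xlnx: "continuous_on {0..} xlnx"
  unfolding continuous_on_def
proof
  fix t :: real assume "t \<in> {0..}"
  then consider "t = 0" | "t > 0" by force
  then show "(xlnx \<longlongrightarrow> xlnx t) (at t within {0..})"
  proof cases
    case 1
    have "((\<lambda>t :: real. t * ln t) \<longlongrightarrow> 0) (at_right 0)" by real_asymp
    then show ?thesis using 1 by (simp add: at_within_Ici_at_right xlnx_def[abs_def])
  next
    case 2
    then have "isCont xlnx t" unfolding xlnx_def[abs_def] by (intro continuous_intros) auto
    then show ?thesis unfolding isCont_def by (rule tendsto_within_subset) simp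
  qed
qed

lemma continuous_on_xlnx_compose:
  "continuous_on S f \<Longrightarrow> (\<And>x. x \<in> S \<Longrightarrow> f x \<ge> 0) \<Longrightarrow> continuous_on S (\<lambda>x. xlnx (f x))"
  by (rule continuous_on_compose2[OF continuous_on_xlnx]) auto

text \<open>Turns perturbations of order 1/n in the arguments, caused by tags and rounding, into
  arbitrarily small errors, even where the derivative is unbounded near 0.\<close>

lemma xlnx_uniformly_continuous:
  assumes "e > 0"
  obtains d where "d > 0"
    "\<And>s t. \<lbrakk>0 \<le> s; s \<le> 1; 0 \<le> t; t \<le> 1; \<bar>s - t\<bar> < d\<rbrakk> \<Longrightarrow> \<bar>xlnx s - xlnx t\<bar> < e"
proof -
  have "uniformly_continuous_on {0..1} xlnx"
    by (rule compact_uniformly_continuous)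
       (auto intro: continuous_on_subset[OF continuous_on_xlnx])
  then show thesis
    using assms that unfolding uniformly_continuous_on_def dist_real_def
    by (metis atLeastAtMost_iff)
qed

text \<open>Convexity: the right-hand side is the tangent of \<open>xlnx\<close> at
  \<open>s\<close>. It reduces to ln r \<le> r - 1 with r = s/t.\<close>

lemma xlnx_ge_tangent:
  assumes "t \<ge> 0" "s > 0"
  shows "xlnx t \<ge> t * ln s + t - s"
proof (cases "t = 0")
  case False
  then have t: "t > 0" using assms by simp
  have "ln s - ln t = ln (s / t)" using assms t by (simp add: ln_div)
  also have "\<dots> \<le> s / t - 1" using assms t by (intro ln_le_minus_one) simp
  finally have "t * (ln s - ln t) \<le> t * (s / t - 1)" using t by (intro mult_left_mono) auto
  also have "\<dots> = s - t" using t by (simp add: field_simps)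
  finally show ?thesis by (simp add: xlnx_def algebra_simps)
qed (use assms in simp)

text \<open>These are 1/(m+1) \<le> ln(1 + 1/m) \<le> 1/m, the induction steps for the factorial
  bounds. The exception \<open>m = 0\<close> arises from the convention
  \<open>ln 0 = 0\<close>.\<close>

lemma ln_Suc_diff_bounds:
  "real m * (ln (real m + 1) - ln (real m)) \<le> 1"
  "(real m + 1) * (ln (real m + 1) - ln (real m)) \<ge> 1 \<or> m = 0"
proof -
  show "real m * (ln (real m + 1) - ln (real m)) \<le> 1"
  proof (cases "m = 0")
    case False
    have "ln (real m + 1) - ln (real m) \<le> 1 / real m"
      using ln_diff_le[of "real m + 1" "real m"] False by simp
    then have "real m * (ln (real m + 1) - ln (real m)) \<le> real m * (1 / real m)"
      by (intro mult_left_mono) auto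
    then show ?thesis using False by simp
  qed simp
  show "(real m + 1) * (ln (real m + 1) - ln (real m)) \<ge> 1 \<or> m = 0"
  proof (cases "m = 0")
    case False
    have "ln (real m) - ln (real m + 1) \<le> - 1 / (real m + 1)"
      using ln_diff_le[of "real m" "real m + 1"] False by simp
    then have "(real m + 1) * (1 / (real m + 1)) \<le> (real m + 1) * (ln (real m + 1) - ln (real m))"
      by (intro mult_left_mono) auto
    then show ?thesis by simp
  qed simp
qed

lemma ln_fact_ge: "xlnx (real m) - real m \<le> ln (fact m)"
proof (induction m)
  case (Suc m)
  have "ln (fact (Suc m) :: real) = ln (real m + 1) + ln (fact m)"
    by (simp add: ln_mult add_ac)
  then show ?case
    using Suc.IH ln_Suc_diff_bounds(1)[of m] by (simp add: xlnx_def algebra_simps)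
qed simp

lemma ln_fact_le: "ln (fact m) \<le> xlnx (real m) - real m + (1 + ln (real m + 1))"
proof -
  \<comment> \<open>The induction needs this form with \<open>m + 1\<close>; the first difference
    bound then converts it at the price of an additive constant.\<close>
  have "ln (fact m) \<le> (real m + 1) * ln (real m + 1) - real m"
  proof (induction m)
    case (Suc m)
    have "ln (fact (Suc m) :: real) = ln (real m + 1) + ln (fact m)"
      by (simp add: ln_mult add_ac)
    then show ?case
      using Suc.IH ln_Suc_diff_bounds(2)[of "Suc m"] by (simp add: algebra_simps)
  qed simp
  then show ?thesis
    using ln_Suc_diff_bounds(1)[of m] by (simp add: xlnx_def algebra_simps)
qed

section \<open>The growth rate of matching counts and its concavity\<close>

definition G :: "real \<Rightarrow> real \<Rightarrow> real" where
  "G x y = xlnx x + xlnx (1 - x) - xlnx y - xlnx (x - y) - xlnx (1 - x - y)"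

text \<open>Expanding the quotients inside \<open>h\<close> and the logarithm, the terms y ln x and
  y ln(1 - x) cancel. Unlike \<open>F\<close>, \<open>G\<close> has no quotients: it has one term
  for each factorial in \<open>matching_count\<close> and is visibly continuous up to the
  boundary.\<close>

lemma F_eq_G:
  assumes "0 \<le> x" "x \<le> 1" "0 \<le> y" "y \<le> x" "y \<le> 1 - x"
  shows "F x y = - 2 + 6 * G x y"
proof (cases "x * (1 - x) = 0")
  case True
  then have "x = 0 \<or> x = 1" "y = 0" using assms by auto
  then show ?thesis by (auto simp: F_def G_def h_def xlnx_def)
next
  case False
  then have x: "0 < x" "x < 1" using assms by auto
  have h: "z * h (y / z) = xlnx (z - y) - (z - y) * ln z" if "z > 0" "y \<le> z" for z
  proof (cases "y = z")
    case False
    then have "1 - y / z = (z - y) / z" "z - y > 0" using that by (auto simp: field_simps)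
    then show ?thesis using that by (simp add: h_def xlnx_def ln_div field_simps)
  qed (use that in \<open>simp add: h_def\<close>)
  have "y * ln (y / (x * (1 - x))) = xlnx y - y * ln x - y * ln (1 - x)"
  proof (cases "y = 0")
    case False
    then have "ln (y / (x * (1 - x))) = ln y - (ln x + ln (1 - x))"
      using x assms by (simp add: ln_div ln_mult)
    then show ?thesis by (simp only: xlnx_def right_diff_distrib distrib_left diff_diff_eq)
  qed simp
  moreover have "F x y = - 2 - 6 * (x * h (y / x)) - 6 * ((1 - x) * h (y / (1 - x)))
      - 6 * (y * ln (y / (x * (1 - x))))"
    by (simp add: F_def)
  ultimately show ?thesis
    using h[of x] h[of "1 - x"] x assms by (simp add: G_def xlnx_def algebra_simps)
qed

text \<open>Each of the three \<open>y\<close>-dependent terms of \<open>G\<close> is concave and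
  lies below its tangent at \<open>u\<close>. The slopes add up to ln(x - u) + ln(1 - x - u) - ln u
  + 1, which the equation for \<open>u\<close> turns into ln c + 1.\<close>

lemma G_le_tangent:
  assumes u: "0 < u" "u < x" "u < 1 - x" and c: "c > 0" "(x - u) * (1 - x - u) = c * u"
    and y: "0 \<le> y" "y \<le> x" "y \<le> 1 - x"
  shows "G x y \<le> G x u + (ln c + 1) * (y - u)"
proof -
  have "ln (x - u) + ln (1 - x - u) = ln c + ln u"
    using u c ln_mult[of "x - u" "1 - x - u"] ln_mult[of c u] by simp
  then have "y * (ln (x - u) + ln (1 - x - u)) = y * (ln c + ln u)"
    "u * (ln (x - u) + ln (1 - x - u)) = u * (ln c + ln u)" by simp_all
  then show ?thesis
    using xlnx_ge_tangent[of y u] xlnx_ge_tangent[of "x - y" "x - u"]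
      xlnx_ge_tangent[of "1 - x - y" "1 - x - u"] u y
    by (simp add: G_def xlnx_def algebra_simps)
qed

section \<open>The explicit maximiser\<close>

text \<open>The smaller root \<open>u\<close> of \<open>(x - u) (1 - x - u) = c u\<close>, which is the stationarity condition
  for maximising \<open>G x u - (ln c + 1) u\<close> over \<open>u\<close>.\<close>

definition opt :: "real \<Rightarrow> real \<Rightarrow> real" where
  "opt c x = ((1 + c) - sqrt ((1 + c)\<^sup>2 - 4 * x * (1 - x))) / 2"

lemma opt_discriminant_ge: "(c :: real) \<ge> 0 \<Longrightarrow> (1 - 2 * x)\<^sup>2 \<le> (1 + c)\<^sup>2 - 4 * x * (1 - x)"
  by (simp add: power2_eq_square algebra_simps)

lemma opt_discriminant_pos:
  assumes "(c :: real) > 0"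
  shows "0 < (1 + c)\<^sup>2 - 4 * x * (1 - x)"
proof -
  have "(1 + c)\<^sup>2 - 4 * x * (1 - x) = (1 - 2 * x)\<^sup>2 + (c\<^sup>2 + 2 * c)"
    by (simp add: power2_eq_square algebra_simps)
  then show ?thesis using assms by (simp add: add_nonneg_pos add_pos_pos)
qed

lemma opt_root:
  assumes "c \<ge> 0"
  shows "(x - opt c x) * (1 - x - opt c x) = c * opt c x"
proof -
  define r where "r = sqrt ((1 + c)\<^sup>2 - 4 * x * (1 - x))"
  have "r\<^sup>2 = (1 + c)\<^sup>2 - 4 * x * (1 - x)"
    unfolding r_def using opt_discriminant_ge[OF assms, of x]
    by (intro real_sqrt_pow2) (meson order_trans zero_le_power2)
  then show ?thesis
    unfolding opt_def r_def[symmetric] by (simp add: power2_eq_square field_simps)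
qed

lemma opt_bounds:
  assumes c: "c > 0" and x: "0 < x" "x < 1"
  shows "0 < opt c x" "opt c x < x" "opt c x < 1 - x"
proof -
  have "sqrt ((1 + c)\<^sup>2 - 4 * x * (1 - x)) < 1 + c"
    using c x by (intro real_less_lsqrt) (auto simp: mult_pos_pos)
  then show "0 < opt c x" by (simp add: opt_def)
  \<comment> \<open>The discriminant exceeds this square by 4 c x, and by 4 c (1 - x) in the
    symmetric case below.\<close>
  have "(1 + c - 2 * x)\<^sup>2 < (1 + c)\<^sup>2 - 4 * x * (1 - x)"
    using c x by (simp add: power2_eq_square algebra_simps)
  then have "1 + c - 2 * x < sqrt ((1 + c)\<^sup>2 - 4 * x * (1 - x))"
    by (rule real_less_rsqrt)
  then show "opt c x < x" by (simp add: opt_def field_simps)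
  have "(1 - x) * c > 0" using c x by simp
  then have "(1 + c - 2 * (1 - x))\<^sup>2 < (1 + c)\<^sup>2 - 4 * x * (1 - x)"
    by (simp add: power2_eq_square algebra_simps)
  then have "1 + c - 2 * (1 - x) < sqrt ((1 + c)\<^sup>2 - 4 * x * (1 - x))"
    by (rule real_less_rsqrt)
  then show "opt c x < 1 - x" by (simp add: opt_def field_simps)
qed

lemma opt_endpoints: "c \<ge> 0 \<Longrightarrow> opt c 0 = 0" "c \<ge> 0 \<Longrightarrow> opt c 1 = 0"
  by (simp_all add: opt_def)

lemma opt_bounds_closed:
  assumes "c > 0" "0 \<le> x" "x \<le> 1"
  shows "0 \<le> opt c x" "opt c x \<le> x" "opt c x \<le> 1 - x"
proof -
  consider "x = 0" | "x = 1" | "0 < x \<and> x < 1" using assms by linarith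
  then show "0 \<le> opt c x" "opt c x \<le> x" "opt c x \<le> 1 - x"
    using opt_endpoints[of c] opt_bounds[of c x] assms by (cases; simp)+
qed

text \<open>Extends the tangent inequality to the endpoints, where \<open>y\<close> and
  \<open>opt c x\<close> are both forced to be 0.\<close>

lemma G_le_tangent_opt:
  assumes c: "c > 0" and x: "0 \<le> x" "x \<le> 1" and y: "0 \<le> y" "y \<le> x" "y \<le> 1 - x"
  shows "G x y \<le> G x (opt c x) + (ln c + 1) * (y - opt c x)"
proof (cases "0 < x \<and> x < 1")
  case True
  then show ?thesis
    using opt_bounds[OF c, of x] opt_root[of c x] c y by (intro G_le_tangent) auto
next
  case False
  then have "x = 0 \<or> x = 1" "y = 0" using x y by auto
  then show ?thesis using opt_endpoints[of c] c by auto
qed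

lemma opt_has_derivative:
  assumes "c > 0"
  shows "(opt c has_real_derivative (1 - 2 * x) / sqrt ((1 + c)\<^sup>2 - 4 * x * (1 - x)))
    (at x within S)"
  unfolding opt_def using opt_discriminant_pos[OF assms, of x]
  by (auto intro!: derivative_eq_intros simp: field_simps)

lemma opt_deriv_le:
  assumes "c > 0"
  shows "\<bar>(1 - 2 * x) / sqrt ((1 + c)\<^sup>2 - 4 * x * (1 - x))\<bar> \<le> 1"
proof -
  have "\<bar>1 - 2 * x\<bar> \<le> sqrt ((1 + c)\<^sup>2 - 4 * x * (1 - x))"
    using opt_discriminant_ge[of c x] assms by (intro real_le_rsqrt) auto
  then show ?thesis
    using opt_discriminant_pos[OF assms, of x] by (simp add: abs_divide)
qed

text \<open>A quantitative modulus of continuity: it keeps the Riemann sum of \<open>opt c\<close>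
  within a constant of n times the integral, which mere continuity would not give.\<close>

lemma opt_lipschitz: "c > 0 \<Longrightarrow> \<bar>opt c x - opt c y\<bar> \<le> \<bar>x - y\<bar>"
  using field_differentiable_bound[of UNIV "opt c"
      "\<lambda>x. (1 - 2 * x) / sqrt ((1 + c)\<^sup>2 - 4 * x * (1 - x))" 1 x y]
    opt_has_derivative opt_deriv_le by auto

lemma continuous_on_opt: "continuous_on S (opt c)"
  unfolding opt_def by (intro continuous_intros) auto

section \<open>Fixing the multiplier and evaluating the supremum\<close>

lemma integral_x_one_minus_x:
  "((\<lambda>x::real. x * (1 - x)) has_integral 1 / 6) {0..1}"
  "((\<lambda>x::real. x * (1 - x) + x\<^sup>2 * (1 - x)\<^sup>2) has_integral 1 / 5) {0..1}"
proof -
  have "((\<lambda>x::real. x * (1 - x)) has_integral (1^2/2 - 1^3/3) - (0^2/2 - 0^3/3)) {0..1}"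
    by (rule fundamental_theorem_of_calculus)
       (auto intro!: derivative_eq_intros
         simp: has_real_derivative_iff_has_vector_derivative [symmetric] power2_eq_square algebra_simps)
  then show "((\<lambda>x::real. x * (1 - x)) has_integral 1 / 6) {0..1}" by simp
  have "((\<lambda>x::real. x * (1 - x) + x\<^sup>2 * (1 - x)\<^sup>2) has_integral
      (1^2/2 - 1^4/2 + 1^5/5) - (0^2/2 - 0^4/2 + 0^5/5)) {0..1}"
    by (rule fundamental_theorem_of_calculus)
       (auto intro!: derivative_eq_intros
         simp: has_real_derivative_iff_has_vector_derivative [symmetric] power2_eq_square
           power3_eq_cube power4_eq_xxxx algebra_simps)
  then show "((\<lambda>x::real. x * (1 - x) + x\<^sup>2 * (1 - x)\<^sup>2) has_integral 1 / 5) {0..1}" by simp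
qed

text \<open>The integral is continuous in \<open>c\<close>, at most 1/6 at \<open>c = 1\<close> and
  greater than 1/6 at \<open>c = 0\<close>. Strictness at 0 makes the intermediate value
  positive.\<close>

lemma opt_parameter_exists: "\<exists>c>0. integral {0..1} (opt c) = 1 / 6"
proof -
  have integrable: "opt c integrable_on {0..1}" for c
    by (rule integrable_continuous_real[OF continuous_on_opt])
  have "continuous_on ({0..1} \<times> cbox 0 1) (\<lambda>(c, x). opt c x)"
    unfolding opt_def split_def by (intro continuous_intros) auto
  then have cont: "continuous_on {0..1} (\<lambda>c. integral {0..1} (opt c))"
    using integral_continuous_on_param[of "{0..1}" 0 1 opt] by simp
  have "integral {0..1} (opt 1) \<le> integral {0..1} (\<lambda>x. x * (1 - x))"
  proof (intro integral_le integrable)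
    show "(\<lambda>x::real. x * (1 - x)) integrable_on {0..1}"
      using integral_x_one_minus_x(1) by blast
    fix x :: real assume x: "x \<in> {0..1}"
    define u where "u = opt 1 x"
    have u: "0 \<le> u" "u \<le> 1" using opt_bounds_closed[of 1 x] x by (auto simp: u_def)
    \<comment> \<open>The root equation for \<open>c = 1\<close>, rearranged.\<close>
    have "x * (1 - x) = u + u * (1 - u)"
      using opt_root[of 1 x] by (simp add: u_def[symmetric] algebra_simps)
    then show "opt 1 x \<le> x * (1 - x)" using u by (simp add: u_def)
  qed
  then have upper: "integral {0..1} (opt 1) \<le> 1 / 6"
    using integral_x_one_minus_x(1) by (simp add: integral_unique)
  \<comment> \<open>\<open>opt 0 x\<close> is \<open>min x (1 - x)\<close>. A polynomial minorant
    with integral 1/5 > 1/6 avoids integrating this function piecewise.\<close>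
  have "integral {0..1} (\<lambda>x. x * (1 - x) + x\<^sup>2 * (1 - x)\<^sup>2) \<le> integral {0..1} (opt 0)"
  proof (intro integral_le integrable)
    show "(\<lambda>x::real. x * (1 - x) + x\<^sup>2 * (1 - x)\<^sup>2) integrable_on {0..1}"
      using integral_x_one_minus_x(2) by blast
    fix x :: real assume x: "x \<in> {0..1}"
    have "(1 + 0)\<^sup>2 - 4 * x * (1 - x) = (1 - 2 * x)\<^sup>2"
      by (simp add: power2_eq_square algebra_simps)
    then have opt0: "opt 0 x = (1 - \<bar>1 - 2 * x\<bar>) / 2" by (simp add: opt_def)
    have "x\<^sup>2 * (1 - x)\<^sup>2 \<le> x\<^sup>2 * 1" "x\<^sup>2 * (1 - x)\<^sup>2 \<le> 1 * (1 - x)\<^sup>2"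
      using x by (intro mult_left_mono mult_right_mono; simp add: power_le_one)+
    then have "x * (1 - x) + x\<^sup>2 * (1 - x)\<^sup>2 \<le> x" "x * (1 - x) + x\<^sup>2 * (1 - x)\<^sup>2 \<le> 1 - x"
      by (simp_all add: power2_eq_square algebra_simps)
    then show "x * (1 - x) + x\<^sup>2 * (1 - x)\<^sup>2 \<le> opt 0 x"
      unfolding opt0 by (auto simp: abs_if)
  qed
  then have lower: "1 / 6 < integral {0..1} (opt 0)"
    using integral_x_one_minus_x(2) by (simp add: integral_unique)
  obtain c where c: "0 \<le> c" "c \<le> 1" "integral {0..1} (opt c) = 1 / 6"
    using IVT2'[of "\<lambda>c. integral {0..1} (opt c)" 1 "1 / 6" 0] upper lower cont by auto
  moreover have "c \<noteq> 0" using c(3) lower by auto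
  ultimately show ?thesis by (intro exI[of _ c]) auto
qed

lemma opt_in_C1_tri:
  assumes "c > 0" "integral {0..1} (opt c) = 1 / 6"
  shows "opt c \<in> C1_tri"
proof -
  have "sqrt ((1 + c)\<^sup>2 - 4 * x * (1 - x)) \<noteq> 0" for x
    using opt_discriminant_pos[OF assms(1), of x] by simp
  then have "continuous_on {0..1} (\<lambda>x. (1 - 2 * x) / sqrt ((1 + c)\<^sup>2 - 4 * x * (1 - x)))"
    by (intro continuous_intros) auto
  then show ?thesis
    unfolding C1_tri_def
    using opt_has_derivative[OF assms(1)] opt_bounds_closed[OF assms(1)] assms(2)
    by auto
qed

lemma continuous_on_G_opt: "c > 0 \<Longrightarrow> continuous_on {0..1} (\<lambda>x. G x (opt c x))"
  unfolding G_def
  by (intro continuous_intros continuous_on_xlnx_compose continuous_on_opt)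
     (auto simp: opt_bounds_closed)

text \<open>In the integrated tangent inequality the linear term vanishes, since every competitor
  has the same integral 1/6 as \<open>opt c\<close>. Being itself admissible, \<open>opt c\<close>
  attains the supremum.\<close>

lemma beta_eq:
  assumes c: "c > 0" "integral {0..1} (opt c) = 1 / 6"
  shows "beta = - 2 + 6 * integral {0..1} (\<lambda>x. G x (opt c x))"
proof -
  have int: "(\<lambda>x. G x (opt c x)) integrable_on {0..1}" "opt c integrable_on {0..1}"
    by (intro integrable_continuous_real continuous_on_G_opt continuous_on_opt c)+
  have F_opt: "integral {0..1} (\<lambda>x. F x (opt c x)) =
      - 2 + 6 * integral {0..1} (\<lambda>x. G x (opt c x))"
  proof -
    have "integral {0..1} (\<lambda>x. F x (opt c x)) = integral {0..1} (\<lambda>x. - 2 + 6 * G x (opt c x))"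
      using opt_bounds_closed[OF c(1)] by (intro integral_cong F_eq_G) auto
    also have "\<dots> = integral {0..1} (\<lambda>x::real. - 2 :: real) + integral {0..1} (\<lambda>x. 6 * G x (opt c x))"
      using int by (intro integral_add integrable_on_cmult_left) auto
    finally show ?thesis by simp
  qed
  have "integral {0..1} (\<lambda>x. F x (u x)) \<le> integral {0..1} (\<lambda>x. F x (opt c x))" if u: "u \<in> C1_tri" for u
  proof -
    have cu: "continuous_on {0..1} u" and iu: "integral {0..1} u = 1 / 6"
      and bu: "\<And>x. x \<in> {0..1} \<Longrightarrow> 0 \<le> u x \<and> u x \<le> min x (1 - x)"
      using u unfolding C1_tri_def by (auto intro: DERIV_continuous_on)
    have u_int: "u integrable_on {0..1}" by (rule integrable_continuous_real[OF cu])
    have d_int: "(\<lambda>x. 6 * (ln c + 1) * (u x - opt c x)) integrable_on {0..1}"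
      using integrable_on_cmult_left[OF integrable_diff[OF u_int int(2)], of "6 * (ln c + 1)"] by simp
    have F_int: "(\<lambda>x. F x (opt c x)) integrable_on {0..1}"
      by (rule F_integrable[OF opt_in_C1_tri[OF c]])
    have "integral {0..1} (\<lambda>x. F x (u x)) \<le>
        integral {0..1} (\<lambda>x. F x (opt c x) + 6 * (ln c + 1) * (u x - opt c x))"
    proof (intro integral_le F_integrable[OF u] integrable_add F_int d_int)
      fix x :: real assume x: "x \<in> {0..1}"
      show "F x (u x) \<le> F x (opt c x) + 6 * (ln c + 1) * (u x - opt c x)"
        using G_le_tangent_opt[OF c(1), of x "u x"] bu[OF x] x opt_bounds_closed[OF c(1), of x]
          F_eq_G[of x "u x"] F_eq_G[of x "opt c x"] by (simp add: algebra_simps)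
    qed
    also have "\<dots> = integral {0..1} (\<lambda>x. F x (opt c x)) +
        6 * (ln c + 1) * (integral {0..1} u - integral {0..1} (opt c))"
      using F_int d_int u_int int by (simp add: integral_add integral_diff)
    finally show ?thesis using iu c by simp
  qed
  then have "beta = integral {0..1} (\<lambda>x. F x (opt c x))"
    unfolding beta_def using opt_in_C1_tri[OF c] bdd_above_F
    by (intro antisym cSUP_least cSUP_upper) auto
  then show ?thesis using F_opt by simp
qed

section \<open>Riemann sums and Stirling estimates\<close>

text \<open>Half-integer tags keep the sample points strictly inside the unit interval, and the
  cell \<open>j\<close> then has \<open>j - 1 = n x - 1/2\<close> elements below and \<open>n - j = n (1 - x) - 1/2\<close> above.\<close>

definition tag :: "nat \<Rightarrow> nat \<Rightarrow> real" where
  "tag n j = (real j - 1 / 2) / real n"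

lemma tag_bounds:
  assumes "j \<in> {1..n}"
  shows "0 < tag n j" "tag n j < 1"
  using assms by (auto simp: tag_def field_simps)

text \<open>Induction over the cells: each tag lies in its cell of length 1/n, so a cell contributes
  at most \<open>e\<close> after scaling by n. The oscillation bound is explicit so that a Lipschitz
  function can take \<open>e\<close> as small as 1/n.\<close>

lemma riemann_sum_error:
  fixes f :: "real \<Rightarrow> real"
  assumes cont: "continuous_on {0..1} f" and n: "n > 0"
    and osc: "\<And>x y. \<lbrakk>x \<in> {0..1}; y \<in> {0..1}; \<bar>x - y\<bar> \<le> 1 / real n\<rbrakk> \<Longrightarrow> \<bar>f x - f y\<bar> \<le> e"
  shows "\<bar>(\<Sum>j\<in>{1..n}. f (tag n j)) - real n * integral {0..1} f\<bar> \<le> real n * e"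
proof -
  have "\<bar>(\<Sum>j\<in>{1..m}. f (tag n j)) - real n * integral {0..real m / real n} f\<bar> \<le> real m * e"
    if "m \<le> n" for m
    using that
  proof (induction m)
    case (Suc m)
    define a b where "a = real m / real n" and "b = real (Suc m) / real n"
    have ab: "0 \<le> a" "a \<le> b" "b \<le> 1" "b - a = 1 / real n"
      using Suc.prems n by (auto simp: a_def b_def field_simps)
    have t: "a \<le> tag n (Suc m)" "tag n (Suc m) \<le> b"
      using n by (auto simp: a_def b_def tag_def field_simps)
    have int: "f integrable_on {0..b}" "f integrable_on {a..b}"
      using ab by (auto intro!: integrable_continuous_real intro: continuous_on_subset[OF cont])
    have "norm (integral {a..b} (\<lambda>x. f x - f (tag n (Suc m)))) \<le> e * (b - a)"
    proof (rule integral_bound)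
      show "continuous_on {a..b} (\<lambda>x. f x - f (tag n (Suc m)))"
        using ab by (auto intro!: continuous_intros intro: continuous_on_subset[OF cont])
      fix x assume "x \<in> {a..b}"
      then show "norm (f x - f (tag n (Suc m))) \<le> e"
        using ab t by (auto intro!: osc)
    qed (use ab in auto)
    moreover have "integral {a..b} (\<lambda>x. f x - f (tag n (Suc m))) =
        integral {a..b} f - (b - a) * f (tag n (Suc m))"
      using int(2) ab(2) by (subst integral_diff) auto
    ultimately have "\<bar>integral {a..b} f - 1 / real n * f (tag n (Suc m))\<bar> \<le> e * (1 / real n)"
      using ab(4) by simp
    then have "real n * \<bar>integral {a..b} f - 1 / real n * f (tag n (Suc m))\<bar> \<le> real n * (e * (1 / real n))"
      by (rule mult_left_mono) simp
    also have "real n * \<bar>integral {a..b} f - 1 / real n * f (tag n (Suc m))\<bar> =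
        \<bar>real n * (integral {a..b} f - 1 / real n * f (tag n (Suc m)))\<bar>"
      by (simp add: abs_mult)
    also have "real n * (integral {a..b} f - 1 / real n * f (tag n (Suc m))) =
        real n * integral {a..b} f - f (tag n (Suc m))"
      using n by (simp add: algebra_simps)
    finally have step: "\<bar>real n * integral {a..b} f - f (tag n (Suc m))\<bar> \<le> e"
      using n by simp
    have "integral {0..b} f = integral {0..a} f + integral {a..b} f"
      using Henstock_Kurzweil_Integration.integral_combine[of 0 a b f] ab int by simp
    then have "(\<Sum>j\<in>{1..Suc m}. f (tag n j)) - real n * integral {0..b} f =
        ((\<Sum>j\<in>{1..m}. f (tag n j)) - real n * integral {0..a} f) -
        (real n * integral {a..b} f - f (tag n (Suc m)))"
      by (simp add: algebra_simps)
    then show ?case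
      using step Suc.IH Suc.prems unfolding a_def[symmetric] b_def[symmetric]
      by (simp add: algebra_simps)
  qed simp
  from this[of n] show ?thesis using n by simp
qed

lemma riemann_sum_eventually:
  fixes f :: "real \<Rightarrow> real"
  assumes cont: "continuous_on {0..1} f" and e: "e > 0"
  shows "\<forall>\<^sub>F n in sequentially.
    \<bar>(\<Sum>j\<in>{1..n}. f (tag n j)) - real n * integral {0..1} f\<bar> \<le> real n * e"
proof -
  have "uniformly_continuous_on {0..1} f"
    by (rule compact_uniformly_continuous[OF cont]) simp
  then obtain d where d: "d > 0" "\<And>x y. \<lbrakk>x \<in> {0..1}; y \<in> {0..1}; \<bar>x - y\<bar> < d\<rbrakk> \<Longrightarrow> \<bar>f x - f y\<bar> < e"
    using e unfolding uniformly_continuous_on_def dist_real_def by metis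
  have "(\<lambda>n. 1 / real n) \<longlonglongrightarrow> 0" by real_asymp
  then have "\<forall>\<^sub>F n in sequentially. 1 / real n < d"
    using d(1) by (rule order_tendstoD)
  moreover have "\<forall>\<^sub>F n in sequentially. n > 0" by (rule eventually_gt_at_top)
  ultimately show ?thesis
  proof eventually_elim
    case (elim n)
    show ?case
    proof (rule riemann_sum_error[OF cont])
      show "\<bar>f x - f y\<bar> \<le> e" if "x \<in> {0..1}" "y \<in> {0..1}" "\<bar>x - y\<bar> \<le> 1 / real n" for x y
        using that elim d(2)[of x y] by linarith
    qed (use elim in auto)
  qed
qed

section \<open>Uniform Stirling estimate for the number of matchings\<close>

lemma xlnx_scale:
  assumes "n > 0" "m \<ge> 0"
  shows "xlnx m = n * xlnx (m / n) + m * ln n"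
  using assms by (cases "m = 0") (simp_all add: xlnx_def ln_div algebra_simps)

text \<open>Stirling is applied to the five factorials and every argument is scaled by n. As a + b -
  k - (a - k) - (b - k) = k, the coefficients of ln n add up to k and the linear terms to -k. The
  error is uniform in \<open>j\<close> and \<open>k\<close>: half of it pays for Stirling, half for
  the shift of the arguments.\<close>

lemma ln_matching_count_approx:
  assumes e: "e > 0"
  shows "\<forall>\<^sub>F n in sequentially. \<forall>j\<in>{1..n}. \<forall>k\<le>min (j - 1) (n - j).
    \<bar>ln (matching_count (j - 1) (n - j) k) -
      (real n * G (tag n j) (real k / real n) + real k * (ln (real n) - 1))\<bar> \<le> e * real n"
proof -
  obtain d where d: "d > 0" "\<And>s t. \<lbrakk>0 \<le> s; s \<le> 1; 0 \<le> t; t \<le> 1; \<bar>s - t\<bar> < d\<rbrakk> \<Longrightarrow> \<bar>xlnx s - xlnx t\<bar> < e / 8"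
    using xlnx_uniformly_continuous[of "e / 8"] e by auto
  have "(\<lambda>n. 1 / real n) \<longlonglongrightarrow> 0" by real_asymp
  then have "\<forall>\<^sub>F n in sequentially. 1 / real n < d"
    using d(1) by (rule order_tendstoD)
  moreover have "(\<lambda>n. 5 * (1 + ln (real n + 1)) / real n) \<longlonglongrightarrow> 0" by real_asymp
  then have "\<forall>\<^sub>F n in sequentially. 5 * (1 + ln (real n + 1)) / real n < e / 2"
    by (rule order_tendstoD) (use e in simp)
  moreover have "\<forall>\<^sub>F n in sequentially. n > 0" by (rule eventually_gt_at_top)
  ultimately show ?thesis
  proof eventually_elim
    case (elim n)
    define r where "r = real n"
    define E where "E = 1 + ln (r + 1)"
    have r: "r > 0" and E: "5 * E \<le> e / 2 * r"
      using elim by (auto simp: r_def E_def field_simps)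
    have fact: "\<bar>ln (fact m) - (xlnx (real m) - real m)\<bar> \<le> E" if "m \<le> n" for m
    proof -
      have "ln (real m + 1) \<le> ln (r + 1)" using that by (simp add: r_def)
      then show ?thesis
        using ln_fact_ge[of m] ln_fact_le[of m] by (simp add: E_def abs_le_iff)
    qed
    show ?case
    proof (intro ballI allI impI)
      fix j k assume j: "j \<in> {1..n}" and k: "k \<le> min (j - 1) (n - j)"
      define a b where "a = j - 1" and "b = n - j"
      define x where "x = tag n j"
      have ka: "k \<le> a" "k \<le> b" and an: "a \<le> n" "b \<le> n"
        using j k by (auto simp: a_def b_def)
      have ar: "real a = r * x - 1 / 2" "real b = r * (1 - x) - 1 / 2"
        using j r by (auto simp: a_def b_def x_def tag_def r_def of_nat_diff field_simps)
      have x: "0 < x" "x < 1" using tag_bounds[OF j] by (auto simp: x_def)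
      \<comment> \<open>The half-integer tag shifts an argument by 1/(2n). Four terms are affected,
        each costing e/8; the argument k/n is exact.\<close>
      have close: "\<bar>r * xlnx (real m / r) - r * xlnx y\<bar> \<le> e / 8 * r"
        if "real m = r * y - 1 / 2" "y \<le> 1" for m y
      proof -
        have y: "0 \<le> real m / r" "real m / r = y - 1 / (2 * r)"
          using that r by (auto simp: field_simps)
        moreover have "1 / (2 * r) > 0" "1 / (2 * r) < d"
          using r elim d by (auto simp: r_def field_simps)
        ultimately have "\<bar>xlnx (real m / r) - xlnx y\<bar> < e / 8"
          using that(2) by (intro d(2)) linarith+
        then have "r * \<bar>xlnx (real m / r) - xlnx y\<bar> \<le> r * (e / 8)"
          using r by (intro mult_left_mono) auto
        then show ?thesis using r by (simp add: abs_mult right_diff_distrib[symmetric] mult.commute)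
      qed
      have "\<bar>r * xlnx (real a / r) - r * xlnx x\<bar> \<le> e / 8 * r"
        "\<bar>r * xlnx (real b / r) - r * xlnx (1 - x)\<bar> \<le> e / 8 * r"
        using ar x by (intro close; simp)+
      moreover have
        "\<bar>r * xlnx (real (a - k) / r) - r * xlnx (x - real k / r)\<bar> \<le> e / 8 * r"
        "\<bar>r * xlnx (real (b - k) / r) - r * xlnx (1 - x - real k / r)\<bar> \<le> e / 8 * r"
        using ar x ka r by (intro close; simp add: of_nat_diff right_diff_distrib add_increasing2 diff_le_eq)+
      moreover have "ln (matching_count a b k) =
          ln (fact a) + ln (fact b) - ln (fact k) - ln (fact (a - k)) - ln (fact (b - k))"
        by (simp add: matching_count_def ln_div ln_mult)
      moreover have "\<bar>ln (fact a) - (r * xlnx (real a / r) + real a * ln r - real a)\<bar> \<le> E"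
        "\<bar>ln (fact b) - (r * xlnx (real b / r) + real b * ln r - real b)\<bar> \<le> E"
        "\<bar>ln (fact k) - (r * xlnx (real k / r) + real k * ln r - real k)\<bar> \<le> E"
        "\<bar>ln (fact (a - k)) - (r * xlnx (real (a - k) / r) + real (a - k) * ln r - real (a - k))\<bar> \<le> E"
        "\<bar>ln (fact (b - k)) - (r * xlnx (real (b - k) / r) + real (b - k) * ln r - real (b - k))\<bar> \<le> E"
        using fact[of a] fact[of b] fact[of k] fact[of "a - k"] fact[of "b - k"] ka an
        by (simp_all only: xlnx_scale[OF r of_nat_0_le_iff, symmetric])
      moreover have "real (a - k) * ln r = real a * ln r - real k * ln r"
        "real (b - k) * ln r = real b * ln r - real k * ln r"
        "real (a - k) = real a - real k" "real (b - k) = real b - real k"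
        using ka by (simp_all add: of_nat_diff left_diff_distrib)
      moreover have "r * G x (real k / r) = r * xlnx x + r * xlnx (1 - x) - r * xlnx (real k / r)
          - r * xlnx (x - real k / r) - r * xlnx (1 - x - real k / r)"
        by (simp add: G_def algebra_simps)
      moreover have "real k * (ln r - 1) = real k * ln r - real k"
        by (simp add: algebra_simps)
      ultimately have "\<bar>ln (matching_count a b k) - (r * G x (real k / r) + real k * (ln r - 1))\<bar> \<le> e * r"
        using E unfolding abs_le_iff by linarith
      then show "\<bar>ln (matching_count (j - 1) (n - j) k) -
          (real n * G (tag n j) (real k / real n) + real k * (ln (real n) - 1))\<bar> \<le> e * real n"
        by (simp only: a_def b_def x_def r_def)
    qed
  qed
qed

section \<open>Asymptotics of the counting function\<close>

lemma triple_bound_eq: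
  assumes "n \<ge> 3"
  shows "1 / (real n - 2) * real (n choose 3) = real n * (real n - 1) / 6"
proof -
  have "real (n choose 3) = real n * (real n - 1) * (real n - 2) / 6"
    using assms by (simp add: binomial_gbinomial gbinomial_prod_rev numeral_3_eq_3
        prod.atLeast0_lessThan_Suc algebra_simps)
  then show ?thesis using assms by simp
qed

lemma g_pos: "g n > 0" if "n \<ge> 3"
proof -
  have "(\<Prod>j\<in>{1..n}. matching_count (j - 1) (n - j) 0) \<le> real (g n)"
    using that by (intro g_lower_bound) auto
  moreover have "0 < (\<Prod>j\<in>{1..n}. matching_count (j - 1) (n - j) 0)"
    by (intro prod_pos) (simp add: matching_count_pos)
  ultimately show ?thesis by simp
qed

text \<open>After weighting by \<open>z\<close>, the tangent inequality bounds all terms of an inner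
  sum by the same quantity, so passing from the largest term to the sum costs a factor of at most n
  for each \<open>j\<close>, only n ln n in total. One \<open>e\<close> comes from Stirling and one
  from the Riemann sum.\<close>

lemma ln_g_upper:
  assumes c: "c > 0" "integral {0..1} (opt c) = 1 / 6" and e: "e > 0"
  shows "\<forall>\<^sub>F n in sequentially. ln (real (g n)) \<le>
    real n * (real n - 1) / 6 * (ln (real n) + ln c) + real n * ln (real n) +
    (real n)\<^sup>2 * (integral {0..1} (\<lambda>x. G x (opt c x)) - (ln c + 1) / 6 + 2 * e)"
proof -
  define f where "f x = G x (opt c x) - (ln c + 1) * opt c x" for x
  have cont: "continuous_on {0..1} f"
    unfolding f_def by (intro continuous_intros continuous_on_G_opt continuous_on_opt c)
  have int_f: "integral {0..1} f = integral {0..1} (\<lambda>x. G x (opt c x)) - (ln c + 1) / 6"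
  proof -
    have "integral {0..1} f =
        integral {0..1} (\<lambda>x. G x (opt c x)) - integral {0..1} (\<lambda>x. (ln c + 1) * opt c x)"
      unfolding f_def
      by (intro integral_diff integrable_continuous_real continuous_intros
          continuous_on_G_opt continuous_on_opt c)
    then show ?thesis using c by simp
  qed
  have "filterlim (\<lambda>n. real n * c) at_top sequentially" using c by real_asymp
  then have "\<forall>\<^sub>F n in sequentially. 1 \<le> real n * c"
    by (simp add: filterlim_at_top)
  moreover have "\<forall>\<^sub>F n in sequentially. n \<ge> 3" by (rule eventually_ge_at_top)
  ultimately show ?thesis
    using ln_matching_count_approx[OF e] riemann_sum_eventually[OF cont e]
  proof eventually_elim
    case (elim n)
    \<comment> \<open>With this weight, (ln c + 1) k from the tangent and k (ln n - 1) from Stirling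
      add up to k ln z, which the division by \<open>z ^ k\<close> removes.\<close>
    define z where "z = real n * c"
    have n: "real n > 0" and ln_z: "ln z = ln (real n) + ln c" and z: "z \<ge> 1"
      using elim c by (auto simp: z_def ln_mult)
    define B where "B j = real n * exp (real n * f (tag n j) + e * real n)" for j
    have term_le: "matching_count (j - 1) (n - j) k / z ^ k \<le> exp (real n * f (tag n j) + e * real n)"
      if j: "j \<in> {1..n}" and k: "k \<le> min (j - 1) (n - j)" for j k
    proof -
      define x where "x = tag n j"
      have x: "0 \<le> x" "x \<le> 1" using tag_bounds[OF j] by (auto simp: x_def)
      have "real k / real n \<le> x" "real k / real n \<le> 1 - x"
        using j k n by (auto simp: x_def tag_def field_simps)
      then have "G x (real k / real n) \<le> G x (opt c x) + (ln c + 1) * (real k / real n - opt c x)"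
        using x by (intro G_le_tangent_opt c) auto
      then have "real n * G x (real k / real n) \<le>
          real n * (G x (opt c x) + (ln c + 1) * (real k / real n - opt c x))"
        by (intro mult_left_mono) auto
      also have "\<dots> = real n * f x + (ln c + 1) * real k"
        using n by (simp add: f_def field_simps)
      finally have "ln (matching_count (j - 1) (n - j) k) \<le>
          real n * f x + (ln c + 1) * real k + real k * (ln (real n) - 1) + e * real n"
        using bspec[OF elim(3) j] k unfolding x_def[symmetric] abs_le_iff by fastforce
      also have "\<dots> = real n * f x + e * real n + real k * ln z"
        by (simp add: ln_z algebra_simps)
      finally have "exp (ln (matching_count (j - 1) (n - j) k)) \<le>
          exp (real n * f x + e * real n + real k * ln z)"
        by simp
      then have "matching_count (j - 1) (n - j) k \<le> exp (real n * f x + e * real n) * z ^ k"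
        using z by (simp add: matching_count_pos exp_add exp_of_nat_mult)
      then show ?thesis using z by (simp add: x_def field_simps)
    qed
    have "(\<Sum>k\<le>min (j - 1) (n - j). matching_count (j - 1) (n - j) k / z ^ k) \<le> B j"
      if j: "j \<in> {1..n}" for j
    proof -
      have "(\<Sum>k\<le>min (j - 1) (n - j). matching_count (j - 1) (n - j) k / z ^ k) \<le>
          (\<Sum>k\<le>min (j - 1) (n - j). exp (real n * f (tag n j) + e * real n))"
        using j by (intro sum_mono term_le) auto
      also have "\<dots> = real (Suc (min (j - 1) (n - j))) * exp (real n * f (tag n j) + e * real n)"
        by simp
      also have "\<dots> \<le> B j"
        unfolding B_def using j by (intro mult_right_mono of_nat_mono) auto
      finally show ?thesis .
    qed
    then have "(\<Prod>j\<in>{1..n}. \<Sum>k\<le>min (j - 1) (n - j). matching_count (j - 1) (n - j) k / z ^ k)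
        \<le> (\<Prod>j\<in>{1..n}. B j)"
      using z by (intro prod_mono conjI sum_nonneg) (auto intro!: divide_nonneg_nonneg less_imp_le[OF matching_count_pos])
    then have "z powr (1 / (real n - 2) * real (n choose 3)) *
        (\<Prod>j\<in>{1..n}. \<Sum>k\<le>min (j - 1) (n - j). matching_count (j - 1) (n - j) k / z ^ k)
        \<le> z powr (1 / (real n - 2) * real (n choose 3)) * (\<Prod>j\<in>{1..n}. B j)"
      by (intro mult_left_mono) auto
    with g_upper_bound[OF z, of n]
    have "real (g n) \<le> z powr (1 / (real n - 2) * real (n choose 3)) * (\<Prod>j\<in>{1..n}. B j)"
      by (rule order_trans)
    then have "real (g n) \<le> z powr (real n * (real n - 1) / 6) * (\<Prod>j\<in>{1..n}. B j)"
      using elim(2) by (simp only: triple_bound_eq)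
    moreover have B_pos: "B j > 0" for j using n by (simp add: B_def)
    moreover have ln_B: "ln (\<Prod>j\<in>{1..n}. B j) = (\<Sum>j\<in>{1..n}. ln (B j))"
      by (rule ln_prod) (use B_pos in \<open>auto simp: less_imp_neq[symmetric]\<close>)
    ultimately have "ln (real (g n)) \<le> ln (z powr (real n * (real n - 1) / 6) * (\<Prod>j\<in>{1..n}. B j))"
      using g_pos[of n] elim by (subst ln_le_cancel_iff) (auto intro!: mult_pos_pos prod_pos simp: z_def c)
    also have "\<dots> = real n * (real n - 1) / 6 * ln z + (\<Sum>j\<in>{1..n}. ln (B j))"
      using z B_pos unfolding ln_B[symmetric] by (subst ln_mult_pos) (auto intro!: prod_pos simp: ln_powr)
    also have "(\<Sum>j\<in>{1..n}. ln (B j)) =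
        (\<Sum>j\<in>{1..n}. ln (real n) + (real n * f (tag n j) + e * real n))"
      using n by (intro sum.cong refl) (simp add: B_def ln_mult)
    also have "\<dots> = real n * ln (real n) + real n * (\<Sum>j\<in>{1..n}. f (tag n j)) + e * (real n)\<^sup>2"
      by (simp add: sum.distrib sum_distrib_left power2_eq_square algebra_simps)
    also have "real n * (\<Sum>j\<in>{1..n}. f (tag n j)) \<le> real n * (real n * integral {0..1} f + real n * e)"
      using elim(4) by (intro mult_left_mono) (auto simp: abs_le_iff)
    finally show ?case
      unfolding ln_z int_f by (simp add: power2_eq_square algebra_simps)
  qed
qed

text \<open>A single choice of sizes along the optimal profile suffices. The three \<open>e\<close>
  pay for Stirling, for the rounding of the sizes and for the Riemann sum.\<close>

lemma ln_g_lower: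
  assumes c: "c > 0" "integral {0..1} (opt c) = 1 / 6" and e: "e > 0"
  shows "\<forall>\<^sub>F n in sequentially. ln (real (g n)) \<ge>
    ((real n)\<^sup>2 / 6 - 4 * real n) * (ln (real n) - 1) +
    (real n)\<^sup>2 * (integral {0..1} (\<lambda>x. G x (opt c x)) - 3 * e)"
proof -
  obtain d where d: "d > 0" "\<And>s t. \<lbrakk>0 \<le> s; s \<le> 1; 0 \<le> t; t \<le> 1; \<bar>s - t\<bar> < d\<rbrakk> \<Longrightarrow> \<bar>xlnx s - xlnx t\<bar> < e / 3"
    using xlnx_uniformly_continuous[of "e / 3"] e by auto
  have "(\<lambda>n. 8 / real n) \<longlonglongrightarrow> 0" by real_asymp
  then have "\<forall>\<^sub>F n in sequentially. 8 / real n < d"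
    using d(1) by (rule order_tendstoD)
  moreover have "filterlim (\<lambda>n. ln (real n)) at_top sequentially" by real_asymp
  then have "\<forall>\<^sub>F n in sequentially. 1 \<le> ln (real n)"
    by (simp add: filterlim_at_top)
  moreover have "\<forall>\<^sub>F n in sequentially. n \<ge> 7" by (rule eventually_ge_at_top)
  ultimately show ?thesis
    using ln_matching_count_approx[OF e] riemann_sum_eventually[OF continuous_on_G_opt[OF c(1)] e]
  proof eventually_elim
    case (elim n)
    define u where "u j = opt c (tag n j)" for j
    \<comment> \<open>Scaling by \<open>n - 7\<close> instead of \<open>n\<close> absorbs the error of the Riemann sum, so that the total
      size does not exceed \<open>n (n - 1) / 6\<close>, at a cost of only \<open>O(n)\<close>.\<close>
    define k where "k j = nat \<lfloor>(real n - 7) * u j\<rfloor>" for j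
    have n: "real n \<ge> 7" using elim by simp
    have u: "0 \<le> u j" "u j \<le> tag n j" "u j \<le> 1 - tag n j" "u j \<le> 1" if "j \<in> {1..n}" for j
      using opt_bounds_closed[OF c(1), of "tag n j"] tag_bounds[OF that] by (auto simp: u_def)
    have k_le: "real (k j) \<le> (real n - 7) * u j" and k_ge: "real (k j) \<ge> (real n - 7) * u j - 1"
      if "j \<in> {1..n}" for j
    proof -
      have "0 \<le> (real n - 7) * u j" using n u[OF that] by simp
      then show "real (k j) \<le> (real n - 7) * u j" "real (k j) \<ge> (real n - 7) * u j - 1"
        unfolding k_def by linarith+
    qed
    have k_le': "real (k j) \<le> real n * u j" if "j \<in> {1..n}" for j
      using k_le[OF that] u(1)[OF that] by (simp add: algebra_simps)
    have k_min: "k j \<le> min (j - 1) (n - j)" if j: "j \<in> {1..n}" for j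
    proof -
      have "real n * u j \<le> real n * tag n j" "real n * u j \<le> real n * (1 - tag n j)"
        using u[OF j] by (auto intro!: mult_left_mono)
      moreover have "real n * tag n j = real j - 1 / 2" "real n * (1 - tag n j) = real n - real j + 1 / 2"
        using n by (auto simp: tag_def field_simps)
      ultimately have "real (k j) \<le> real j - 1 / 2" "real (k j) \<le> real n - real j + 1 / 2"
        using k_le'[OF j] by linarith+
      then have "k j < j" "k j + j < n + 1" by linarith+
      then show ?thesis using j by auto
    qed
    \<comment> \<open>The Lipschitz bound permits the oscillation 1/n, hence a total error of at
      most 1.\<close>
    have "\<bar>(\<Sum>j\<in>{1..n}. opt c (tag n j)) - real n * integral {0..1} (opt c)\<bar> \<le> real n * (1 / real n)"
    proof (rule riemann_sum_error[OF continuous_on_opt])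
      show "\<bar>opt c x - opt c y\<bar> \<le> 1 / real n" if "\<bar>x - y\<bar> \<le> 1 / real n" for x y
        using opt_lipschitz[OF c(1), of x y] that by linarith
    qed (use elim in auto)
    then have sum_u: "\<bar>(\<Sum>j\<in>{1..n}. u j) - real n / 6\<bar> \<le> 1"
      using c n by (simp add: u_def)
    have sum_k_le: "real (\<Sum>j\<in>{1..n}. k j) \<le> 1 / (real n - 2) * real (n choose 3)"
    proof -
      have "real (\<Sum>j\<in>{1..n}. k j) \<le> (\<Sum>j\<in>{1..n}. (real n - 7) * u j)"
        unfolding of_nat_sum by (intro sum_mono k_le)
      also have "\<dots> = (real n - 7) * (\<Sum>j\<in>{1..n}. u j)" by (simp add: sum_distrib_left)
      also have "\<dots> \<le> (real n - 7) * (real n / 6 + 1)"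
        using n sum_u by (intro mult_left_mono) auto
      \<comment> \<open>The left-hand side is (n^2 - n - 42)/6, so 7 is enough to compensate for the
        error 1.\<close>
      also have "\<dots> \<le> real n * (real n - 1) / 6"
        by (simp add: field_simps)
      finally show ?thesis using elim(3) by (simp only: triple_bound_eq)
    qed
    have sum_k_ge: "(real n)\<^sup>2 / 6 - 4 * real n \<le> (\<Sum>j\<in>{1..n}. real (k j))"
    proof -
      have "(real n)\<^sup>2 / 6 - 4 * real n \<le> (real n - 7) * (real n / 6 - 1) - real n"
        using n by (simp add: power2_eq_square field_simps)
      also have "\<dots> \<le> (real n - 7) * (\<Sum>j\<in>{1..n}. u j) - real n"
        using n sum_u by (intro diff_right_mono mult_left_mono) auto
      also have "\<dots> = (\<Sum>j\<in>{1..n}. (real n - 7) * u j - 1)"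
        by (simp add: sum_subtractf sum_distrib_left)
      also have "\<dots> \<le> (\<Sum>j\<in>{1..n}. real (k j))" by (intro sum_mono k_ge)
      finally show ?thesis .
    qed
    have term_ge: "real n * G (tag n j) (u j) + real (k j) * (ln (real n) - 1) - 2 * e * real n \<le>
        ln (matching_count (j - 1) (n - j) (k j))" if j: "j \<in> {1..n}" for j
    proof -
      define x y where "x = tag n j" and "y = real (k j) / real n"
      have x: "0 < x" "x < 1" using tag_bounds[OF j] by (auto simp: x_def)
      have "y \<le> u j" using k_le'[OF j] n by (simp add: y_def field_simps)
      \<comment> \<open>The scaling loses at most 7, as \<open>u j\<close> is at most 1, and the
        floor at most 1.\<close>
      moreover have "real n * u j - 8 \<le> real (k j)"
        using k_ge[OF j] u(4)[OF j] by (simp add: algebra_simps)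
      then have "u j \<le> (real (k j) + 8) / real n" using n by (simp add: pos_le_divide_eq mult.commute)
      then have "u j - 8 / real n \<le> y" by (simp add: y_def add_divide_distrib)
      ultimately have "\<bar>y - u j\<bar> < d" using elim(1) by linarith
      moreover have "0 \<le> y" by (simp add: y_def)
      ultimately have "\<bar>xlnx y - xlnx (u j)\<bar> < e / 3" "\<bar>xlnx (x - y) - xlnx (x - u j)\<bar> < e / 3"
        "\<bar>xlnx (1 - x - y) - xlnx (1 - x - u j)\<bar> < e / 3"
        using \<open>y \<le> u j\<close> u[OF j] x unfolding x_def[symmetric] by (intro d(2); linarith)+
      then have "G x (u j) - e \<le> G x y" unfolding G_def by linarith
      then have "real n * (G x (u j) - e) \<le> real n * G x y" by (intro mult_left_mono) auto
      moreover have "real n * G x y + real (k j) * (ln (real n) - 1) - e * real n \<le>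
          ln (matching_count (j - 1) (n - j) (k j))"
        using bspec[OF elim(4) j] k_min[OF j] unfolding x_def y_def abs_le_iff by fastforce
      ultimately show ?thesis unfolding x_def by (simp add: algebra_simps)
    qed
    have "((real n)\<^sup>2 / 6 - 4 * real n) * (ln (real n) - 1) +
        (real n)\<^sup>2 * (integral {0..1} (\<lambda>x. G x (opt c x)) - 3 * e) =
        real n * (real n * integral {0..1} (\<lambda>x. G x (opt c x)) - real n * e) +
        ((real n)\<^sup>2 / 6 - 4 * real n) * (ln (real n) - 1) - 2 * e * (real n)\<^sup>2"
      by (simp add: power2_eq_square algebra_simps)
    \<comment> \<open>The lower bound for the total size may be multiplied by ln n - 1 because this
      factor is nonnegative.\<close>
    also have "\<dots> \<le> real n * (\<Sum>j\<in>{1..n}. G (tag n j) (u j)) +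
        (\<Sum>j\<in>{1..n}. real (k j)) * (ln (real n) - 1) - 2 * e * (real n)\<^sup>2"
      using elim(2,5) sum_k_ge
      by (intro diff_right_mono add_mono mult_left_mono mult_right_mono) (auto simp: u_def abs_le_iff)
    also have "\<dots> = (\<Sum>j\<in>{1..n}. real n * G (tag n j) (u j) + real (k j) * (ln (real n) - 1) - 2 * e * real n)"
      by (simp add: sum.distrib sum_subtractf sum_distrib_left sum_distrib_right power2_eq_square)
    also have "\<dots> \<le> (\<Sum>j\<in>{1..n}. ln (matching_count (j - 1) (n - j) (k j)))"
      by (intro sum_mono term_ge)
    also have "\<dots> = ln (\<Prod>j\<in>{1..n}. matching_count (j - 1) (n - j) (k j))"
      by (rule ln_prod[symmetric]) (auto simp: matching_count_pos less_imp_neq[symmetric])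
    also have "\<dots> \<le> ln (real (g n))"
      using g_lower_bound[of n k, OF k_min sum_k_le] g_pos[of n] elim(3)
      by (subst ln_le_cancel_iff) (auto intro!: prod_pos simp: matching_count_pos)
    finally show ?case .
  qed
qed

text \<open>With the leading term n (n - 1)/6 ln n removed, division by n^2 leaves the limit I -
  1/6; in the upper bound, ln c cancels. Changing the normalisation to n (n - 1)/6 multiplies by 6,
  and 6 I - 1 = 1 + \<open>beta\<close>.\<close>

lemma ln_g_limit:
  "(\<lambda>n. ln (real (g n)) / (real n * (real n - 1) / 6) - ln (real n)) \<longlonglongrightarrow> 1 + beta"
proof -
  obtain c where c: "c > 0" "integral {0..1} (opt c) = 1 / 6"
    using opt_parameter_exists by blast
  define I where "I = integral {0..1} (\<lambda>x. G x (opt c x))"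
  define R where "R n = (ln (real (g n)) - real n * (real n - 1) / 6 * ln (real n)) / (real n)\<^sup>2" for n
  have "R \<longlonglongrightarrow> I - 1 / 6"
  proof (rule order_tendstoI)
    fix a assume "a < I - 1 / 6"
    \<comment> \<open>Three \<open>e\<close> from the lower bound, one from the limit below, and one
      to spare for strictness.\<close>
    define e where "e = (I - 1 / 6 - a) / 5"
    have e: "e > 0" using \<open>a < I - 1 / 6\<close> by (simp add: e_def)
    have "(\<lambda>n. ((((real n)\<^sup>2 / 6 - 4 * real n) * (ln (real n) - 1) -
        real n * (real n - 1) / 6 * ln (real n)) / (real n)\<^sup>2)) \<longlonglongrightarrow> - 1 / 6"
      by real_asymp
    then have "\<forall>\<^sub>F n in sequentially. - 1 / 6 - e < (((real n)\<^sup>2 / 6 - 4 * real n) * (ln (real n) - 1) -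
        real n * (real n - 1) / 6 * ln (real n)) / (real n)\<^sup>2"
      by (rule order_tendstoD) (use e in simp)
    moreover have "\<forall>\<^sub>F n in sequentially. n > 0" by (rule eventually_gt_at_top)
    ultimately show "\<forall>\<^sub>F n in sequentially. a < R n"
      using ln_g_lower[OF c e] unfolding I_def[symmetric]
    proof eventually_elim
      case (elim n)
      have "((((real n)\<^sup>2 / 6 - 4 * real n) * (ln (real n) - 1) + (real n)\<^sup>2 * (I - 3 * e)) -
          real n * (real n - 1) / 6 * ln (real n)) / (real n)\<^sup>2 \<le> R n"
        unfolding R_def using elim(3) by (intro divide_right_mono diff_right_mono) auto
      moreover have "((((real n)\<^sup>2 / 6 - 4 * real n) * (ln (real n) - 1) + (real n)\<^sup>2 * (I - 3 * e)) -
          real n * (real n - 1) / 6 * ln (real n)) / (real n)\<^sup>2 =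
          (((real n)\<^sup>2 / 6 - 4 * real n) * (ln (real n) - 1) -
            real n * (real n - 1) / 6 * ln (real n)) / (real n)\<^sup>2 + (I - 3 * e)"
        using elim(2) by (simp add: add_divide_distrib diff_divide_distrib)
      moreover have "a = I - 1 / 6 - 5 * e" by (simp add: e_def field_simps)
      ultimately show ?case using elim(1) e by linarith
    qed
  next
    fix a assume "I - 1 / 6 < a"
    \<comment> \<open>Two \<open>e\<close> from the upper bound, one from the limit below, and one
      to spare.\<close>
    define e where "e = (a - (I - 1 / 6)) / 4"
    have e: "e > 0" using \<open>I - 1 / 6 < a\<close> by (simp add: e_def)
    define l where "l = ln c"
    have "(\<lambda>n. ((real n * (real n - 1) / 6 * l + real n * ln (real n)) / (real n)\<^sup>2)) \<longlonglongrightarrow> l / 6"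
      by real_asymp
    then have "\<forall>\<^sub>F n in sequentially. (real n * (real n - 1) / 6 * l + real n * ln (real n)) / (real n)\<^sup>2 < l / 6 + e"
      by (rule order_tendstoD) (use e in simp)
    moreover have "\<forall>\<^sub>F n in sequentially. n > 0" by (rule eventually_gt_at_top)
    ultimately show "\<forall>\<^sub>F n in sequentially. R n < a"
      using ln_g_upper[OF c e] unfolding I_def[symmetric] l_def[symmetric]
    proof eventually_elim
      case (elim n)
      have "R n \<le> (real n * (real n - 1) / 6 * (ln (real n) + l) + real n * ln (real n) +
          (real n)\<^sup>2 * (I - (l + 1) / 6 + 2 * e) - real n * (real n - 1) / 6 * ln (real n)) / (real n)\<^sup>2"
        unfolding R_def using elim(3) by (intro divide_right_mono diff_right_mono) auto
      also have "real n * (real n - 1) / 6 * (ln (real n) + l) + real n * ln (real n) +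
          (real n)\<^sup>2 * (I - (l + 1) / 6 + 2 * e) - real n * (real n - 1) / 6 * ln (real n) =
          (real n * (real n - 1) / 6 * l + real n * ln (real n)) +
          (real n)\<^sup>2 * (I - (l + 1) / 6 + 2 * e)"
        by (simp add: distrib_left)
      also have "\<dots> / (real n)\<^sup>2 =
          (real n * (real n - 1) / 6 * l + real n * ln (real n)) / (real n)\<^sup>2 + (I - (l + 1) / 6 + 2 * e)"
        using elim(2) by (simp add: add_divide_distrib)
      finally have "R n < I - 1 / 6 + 3 * e" using elim(1) by (simp add: add_divide_distrib)
      moreover have "a = I - 1 / 6 + 4 * e" by (simp add: e_def field_simps)
      ultimately show ?case using e by linarith
    qed
  qed
  moreover have "(\<lambda>n. (real n)\<^sup>2 / (real n * (real n - 1) / 6)) \<longlonglongrightarrow> 6"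
    by real_asymp
  ultimately have "(\<lambda>n. R n * ((real n)\<^sup>2 / (real n * (real n - 1) / 6))) \<longlonglongrightarrow> (I - 1 / 6) * 6"
    by (rule tendsto_mult)
  moreover have "(I - 1 / 6) * 6 = 1 + beta"
    using beta_eq[OF c] by (simp add: I_def)
  moreover have "\<forall>\<^sub>F n in sequentially. R n * ((real n)\<^sup>2 / (real n * (real n - 1) / 6)) =
      ln (real (g n)) / (real n * (real n - 1) / 6) - ln (real n)"
    using eventually_gt_at_top[of 1]
  proof eventually_elim
    case (elim n)
    then show ?case by (simp add: R_def field_simps)
  qed
  ultimately show ?thesis using tendsto_cong by fastforce
qed

theorem theorem18:
  "\<exists>\<epsilon> :: nat \<Rightarrow> real. \<epsilon> \<in> o(\<lambda>n. real n) \<and>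
     (\<forall>\<^sub>F n in sequentially.
        ln (real (g n)) =
          1 / (real n - 2) * real (n choose 3) * ln (exp (1 + beta) * real n + \<epsilon> n))"
proof -
  define L where "L n = ln (real (g n)) / (real n * (real n - 1) / 6)" for n
  \<comment> \<open>The error is defined as what makes the identity exact for
    \<open>n \<ge> 3\<close>; exponentiating the limit of \<open>L n - ln (real n)\<close> shows
    that it is o(n).\<close>
  define \<epsilon> where "\<epsilon> n = exp (L n) - exp (1 + beta) * real n" for n
  have "(\<lambda>n. exp (L n - ln (real n)) - exp (1 + beta)) \<longlonglongrightarrow> exp (1 + beta) - exp (1 + beta)"
    unfolding L_def by (intro tendsto_intros ln_g_limit)
  moreover have "\<forall>\<^sub>F n in sequentially. exp (L n - ln (real n)) - exp (1 + beta) = \<epsilon> n / real n"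
    using eventually_gt_at_top[of 0]
    by eventually_elim (simp add: \<epsilon>_def exp_diff diff_divide_distrib)
  ultimately have "(\<lambda>n. \<epsilon> n / real n) \<longlonglongrightarrow> 0"
    using tendsto_cong by fastforce
  then have "\<epsilon> \<in> o(\<lambda>n. real n)"
    by (rule smalloI_tendsto) (use eventually_gt_at_top[of 0] in eventually_elim, simp)
  moreover have "\<forall>\<^sub>F n in sequentially. ln (real (g n)) =
      1 / (real n - 2) * real (n choose 3) * ln (exp (1 + beta) * real n + \<epsilon> n)"
    using eventually_ge_at_top[of 3]
  proof eventually_elim
    case (elim n)
    then show ?case
      by (simp only: triple_bound_eq) (simp add: \<epsilon>_def L_def)
  qed
  ultimately show ?thesis by blast
qed

end
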